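(* Fix a category $\mathcal{C}=(A,(M_{a,b})_{a,b\in A},\circ)$. Let $\mathcal{D}=(V,E,\gamma)$ be a $\mathcal{C}$-decorated (not necessarily binary) finite DAG such that the following holds: vertices from $V$ as well as all morphisms $\gamma(\pi)$, for $\pi$ a path in $\mathcal{D}$, fit into a single register of the RAM, and for paths $\pi_1,\pi_2$ in $\mathcal{D}$ such that the terminal vertex of $\pi_1$ is the first vertex of $\pi_2$, the morphism $\gamma(\pi_1)\circ\gamma(\pi_2)$ can be computed from $\gamma(\pi_1)$ and $\gamma(\pi_2)$ in constant time. Let $V_0\subseteq V$ be a distinguished set of target vertices. In time $\mathcal{O}(|\mathcal{D}|)$ one can compute a data structure that allows to enumerate, for a given source vertex $s\in V$, in constant delay the multiset $\{\!\{\langle\omega(\pi),\gamma(\pi)\rangle:\pi\in\mathrm{path}_{\mathcal{D}}(s,V_0)\}\!\}$.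
   Context: A DAG is a finite acyclic directed multigraph $(V,E)$ with $E\subseteq V\times I\times V$ for some index set $I$ (an element $(u,i,v)$ is an edge from $u$ to $v$); $|\mathcal{D}|=|V|+|E|$. A path is a word $\pi=v_1i_1v_2\cdots i_{n-1}v_n$ ($n\ge1$) with $(v_k,i_k,v_{k+1})\in E$ for all $k$; $\omega(\pi)=v_n$ is its terminal vertex; for $n=1$ it is the empty path at $v_1$. $\mathrm{path}_{\mathcal{D}}(s,V_0)$ is the set of all paths from $s$ to a vertex in $V_0$. In a category, composition is written in diagrammatic order: for $\alpha\in M_{a,b}$, $\beta\in M_{b,c}$ we have $\alpha\circ\beta\in M_{a,c}$; $\iota_a$ is the identity of object $a$. A $\mathcal{C}$-decoration $\gamma$ assigns to every vertex $v$ an object $\gamma(v)$ and to every edge $e=(u,i,v)$ a morphism $\gamma(e)\in M_{\gamma(u),\gamma(v)}$. It is extended to paths by $\gamma(\pi)=\gamma(v_1,i_1,v_2)\circ\cdots\circ\gamma(v_{n-1},i_{n-1},v_n)$, and $\gamma(v)=\iota_{\gamma(v)}$ for the empty path at $v$. The machine model is the RAM. To enumerate a multiset with constant delay means to output its elements (each according to its multiplicity) one after the other, followed by an end-of-enumeration marker, with $\mathcal{O}(1)$ time between the starts of consecutive outputs. The data structure is computed before $s$ is known. *)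

theory Defs
  imports Main "HOL-Library.Multiset"
begin

section \<open>Categories\<close>

text \<open>
  Composition is written in diagrammatic order. The operation \<open>Comp\<close> is total
  in HOL, but it is only constrained on composable morphisms of the category.
\<close>

record ('o, 'm) category =
  Obj :: "'o set"
  Hom :: "'o \<Rightarrow> 'o \<Rightarrow> 'm set"
  Comp :: "'m \<Rightarrow> 'm \<Rightarrow> 'm"
  Ident :: "'o \<Rightarrow> 'm"

definition is_category :: "('o, 'm) category \<Rightarrow> bool" where
  "is_category C \<longleftrightarrow>
     (\<forall>a\<in>Obj C. Ident C a \<in> Hom C a a) \<and>
     (\<forall>a\<in>Obj C. \<forall>b\<in>Obj C. \<forall>c\<in>Obj C. \<forall>f\<in>Hom C a b. \<forall>g\<in>Hom C b c.
        Comp C f g \<in> Hom C a c) \<and>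
     (\<forall>a\<in>Obj C. \<forall>b\<in>Obj C. \<forall>f\<in>Hom C a b.
        Comp C (Ident C a) f = f \<and> Comp C f (Ident C b) = f) \<and>
     (\<forall>a\<in>Obj C. \<forall>b\<in>Obj C. \<forall>c\<in>Obj C. \<forall>d\<in>Obj C.
        \<forall>f\<in>Hom C a b. \<forall>g\<in>Hom C b c. \<forall>h\<in>Hom C c d.
        Comp C (Comp C f g) h = Comp C f (Comp C g h))"

section \<open>Decorated DAGs and their paths\<close>

text \<open>The index set of the edges is the type \<open>'i\<close>; finiteness is imposed on the edge set.\<close>

record ('v, 'i, 'o, 'm) decorated_graph =
  verts :: "'v set"
  edges :: "('v \<times> 'i \<times> 'v) set"
  vdec :: "'v \<Rightarrow> 'o"
  edec :: "'v \<times> 'i \<times> 'v \<Rightarrow> 'm"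

definition is_dag :: "('v, 'i, 'o, 'm) decorated_graph \<Rightarrow> bool" where
  "is_dag D \<longleftrightarrow> finite (verts D) \<and> finite (edges D) \<and>
     edges D \<subseteq> verts D \<times> UNIV \<times> verts D \<and>
     acyclic {(u, v). \<exists>i. (u, i, v) \<in> edges D}"

definition is_decoration ::
    "('o, 'm) category \<Rightarrow> ('v, 'i, 'o, 'm) decorated_graph \<Rightarrow> bool" where
  "is_decoration C D \<longleftrightarrow> (\<forall>v\<in>verts D. vdec D v \<in> Obj C) \<and>
     (\<forall>(u, i, v)\<in>edges D. edec D (u, i, v) \<in> Hom C (vdec D u) (vdec D v))"

definition dag_size :: "('v, 'i, 'o, 'm) decorated_graph \<Rightarrow> nat" where
  "dag_size D = card (verts D) + card (edges D)"

text \<open>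
  The path \<open>v\<^sub>1 i\<^sub>1 v\<^sub>2 \<dots> v\<^sub>n\<close> is represented by the pair
  \<open>(v\<^sub>1, [(i\<^sub>1, v\<^sub>2), \<dots>, (i\<^sub>n\<^sub>-\<^sub>1, v\<^sub>n)])\<close>, so that \<open>fst\<close> is the first vertex
  and \<open>(v, [])\<close> is the empty path at \<open>v\<close>.
\<close>

type_synonym ('v, 'i) path = "'v \<times> ('i \<times> 'v) list"

fun steps_ok :: "('v \<times> 'i \<times> 'v) set \<Rightarrow> 'v \<Rightarrow> ('i \<times> 'v) list \<Rightarrow> bool" where
  "steps_ok E v [] \<longleftrightarrow> True"
| "steps_ok E v ((i, u) # p) \<longleftrightarrow> (v, i, u) \<in> E \<and> steps_ok E u p"

definition paths :: "('v, 'i, 'o, 'm) decorated_graph \<Rightarrow> ('v, 'i) path set" where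
  "paths D = {(v, p). v \<in> verts D \<and> steps_ok (edges D) v p}"

definition terminal :: "('v, 'i) path \<Rightarrow> 'v" where
  "terminal \<pi> = (if snd \<pi> = [] then fst \<pi> else snd (last (snd \<pi>)))"

definition paths_from_to ::
    "('v, 'i, 'o, 'm) decorated_graph \<Rightarrow> 'v \<Rightarrow> 'v set \<Rightarrow> ('v, 'i) path set" where
  "paths_from_to D s V0 = {\<pi> \<in> paths D. fst \<pi> = s \<and> terminal \<pi> \<in> V0}"

fun steps_mor ::
    "('o, 'm) category \<Rightarrow> ('v, 'i, 'o, 'm) decorated_graph \<Rightarrow> 'v \<Rightarrow> ('i \<times> 'v) list \<Rightarrow> 'm" where
  "steps_mor C D v [] = Ident C (vdec D v)"
| "steps_mor C D v [(i, u)] = edec D (v, i, u)"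
| "steps_mor C D v ((i, u) # x # p) = Comp C (edec D (v, i, u)) (steps_mor C D u (x # p))"

definition path_mor ::
    "('o, 'm) category \<Rightarrow> ('v, 'i, 'o, 'm) decorated_graph \<Rightarrow> ('v, 'i) path \<Rightarrow> 'm" where
  "path_mor C D \<pi> = steps_mor C D (fst \<pi>) (snd \<pi>)"

lemma finite_paths_from_to:
  assumes "is_dag D"
  shows "finite (paths_from_to D s V0)"
proof -
  let ?R = "{(u, v). \<exists>i. (u, i, v) \<in> edges D}"
  have fin: "finite (edges D)" and acyc: "acyclic ?R"
    using assms by (auto simp: is_dag_def)
  have "?R \<subseteq> (\<lambda>(u, i, v). (u, v)) ` edges D"
    by force
  then have "finite ?R"
    using fin by (meson finite_imageI finite_subset)
  then have wf: "wf (?R\<inverse>)"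
    using acyc by (rule finite_acyclic_wf_converse)
  have "finite {p. steps_ok (edges D) s p}"
    using wf
  proof (induction s rule: wf_induct_rule)
    case (less v)
    let ?X = "(\<Union>(a, i, u)\<in>{e \<in> edges D. fst e = v}.
                 (\<lambda>p. (i, u) # p) ` {p. steps_ok (edges D) u p})"
    have "{p. steps_ok (edges D) v p} \<subseteq> insert [] ?X"
    proof
      fix p assume "p \<in> {p. steps_ok (edges D) v p}"
      then show "p \<in> insert [] ?X"
        by (cases p) force+
    qed
    moreover have "finite ?X"
      using fin by (intro finite_UN_I) (auto intro!: finite_imageI less.IH)
    ultimately show ?case
      by (meson finite.insertI finite_subset)
  qed
  moreover have "paths_from_to D s V0 \<subseteq> Pair s ` {p. steps_ok (edges D) s p}"
    by (auto simp: paths_from_to_def paths_def)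
  ultimately show ?thesis
    by (meson finite_imageI finite_subset)
qed

section \<open>The random access machine\<close>

text \<open>
  A word RAM: working registers and memory cells hold numbers below \<open>2 ^ width\<close>,
  and memory is accessed by indirect addressing. Subtraction is truncated at
  \<open>0\<close>, so that \<open>Sub\<close> followed by \<open>JumpZero\<close> compares two registers. The only
  access to the category is \<open>Compose\<close>, which acts on register contents and
  takes the fixed time \<open>comp_time\<close>; every other instruction takes one time unit.
  An operand \<open>r\<close> of an instruction is the number of a working register.
\<close>

record ram =
  width :: nat
  comp_op :: "nat \<Rightarrow> nat \<Rightarrow> nat"
  comp_time :: nat

datatype instr =
    Const nat nat            \<comment> \<open>target, constant\<close>
  | Move nat nat             \<comment> \<open>target, source\<close>
  | Add nat nat nat          \<comment> \<open>target, two sources\<close>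
  | Sub nat nat nat
  | Compose nat nat nat
  | Load nat nat             \<comment> \<open>target, register with the address\<close>
  | Store nat nat            \<comment> \<open>register with the address, source\<close>
  | Jump nat
  | JumpZero nat nat         \<comment> \<open>tested register, jump target\<close>
  | Output nat nat           \<comment> \<open>outputs a pair of register contents\<close>
  | OutputEnd                \<comment> \<open>outputs the end-of-enumeration marker\<close>
  | Halt

datatype event = Out "nat \<times> nat" | End

text \<open>The trace records each output together with the time at which it starts.\<close>

record config =
  pc :: nat
  reg :: "nat \<Rightarrow> nat"
  mem :: "nat \<Rightarrow> nat"
  clock :: nat
  trace :: "(nat \<times> event) list"

fun instr_time :: "ram \<Rightarrow> instr \<Rightarrow> nat" where
  "instr_time M (Compose r s t) = comp_time M"
| "instr_time M _ = 1"

definition set_reg :: "ram \<Rightarrow> nat \<Rightarrow> nat \<Rightarrow> config \<Rightarrow> config" where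
  "set_reg M r x c = c\<lparr>reg := (reg c)(r := x mod 2 ^ width M), pc := Suc (pc c)\<rparr>"

definition emit :: "event \<Rightarrow> config \<Rightarrow> config" where
  "emit ev c = c\<lparr>trace := trace c @ [(clock c, ev)], pc := Suc (pc c)\<rparr>"

fun exec :: "ram \<Rightarrow> instr \<Rightarrow> config \<Rightarrow> config" where
  "exec M (Const r k) c = set_reg M r k c"
| "exec M (Move r s) c = set_reg M r (reg c s) c"
| "exec M (Add r s t) c = set_reg M r (reg c s + reg c t) c"
| "exec M (Sub r s t) c = set_reg M r (reg c s - reg c t) c"
| "exec M (Compose r s t) c = set_reg M r (comp_op M (reg c s) (reg c t)) c"
| "exec M (Load r s) c = set_reg M r (mem c (reg c s)) c"
| "exec M (Store r s) c = c\<lparr>mem := (mem c)(reg c r := reg c s), pc := Suc (pc c)\<rparr>"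
| "exec M (Jump l) c = c\<lparr>pc := l\<rparr>"
| "exec M (JumpZero r l) c = c\<lparr>pc := (if reg c r = 0 then l else Suc (pc c))\<rparr>"
| "exec M (Output r s) c = emit (Out (reg c r, reg c s)) c"
| "exec M OutputEnd c = emit End c"
| "exec M Halt c = c"

definition halted :: "instr list \<Rightarrow> config \<Rightarrow> bool" where
  "halted P c \<longleftrightarrow> pc c \<ge> length P \<or> P ! pc c = Halt"

definition step :: "ram \<Rightarrow> instr list \<Rightarrow> config \<Rightarrow> config" where
  "step M P c =
     (if halted P c then c
      else (exec M (P ! pc c) c)\<lparr>clock := clock c + instr_time M (P ! pc c)\<rparr>)"

definition start :: "nat \<Rightarrow> (nat \<Rightarrow> nat) \<Rightarrow> config" where
  "start x \<mu> = \<lparr>pc = 0, reg = (\<lambda>_. 0)(0 := x), mem = \<mu>, clock = 0, trace = []\<rparr>"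

text \<open>
  \<open>computes_within M P \<mu> \<mu>' T\<close>: started on memory \<open>\<mu>\<close>, the program \<open>P\<close> halts with
  memory \<open>\<mu>'\<close> after at most \<open>T\<close> time units.
\<close>

definition computes_within ::
    "ram \<Rightarrow> instr list \<Rightarrow> (nat \<Rightarrow> nat) \<Rightarrow> (nat \<Rightarrow> nat) \<Rightarrow> nat \<Rightarrow> bool" where
  "computes_within M P \<mu> \<mu>' T \<longleftrightarrow>
     (\<exists>k. let c = (step M P ^^ k) (start 0 \<mu>)
          in halted P c \<and> mem c = \<mu>' \<and> clock c \<le> T)"

text \<open>
  \<open>enumerates M P \<mu> x xs d\<close>: started on memory \<open>\<mu>\<close> with \<open>x\<close> in register \<open>0\<close>, the
  program \<open>P\<close> outputs the list \<open>xs\<close> and then the end marker, where the first output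
  starts at time at most \<open>d\<close> and consecutive outputs start at most \<open>d\<close> apart.
\<close>

definition enumerates ::
    "ram \<Rightarrow> instr list \<Rightarrow> (nat \<Rightarrow> nat) \<Rightarrow> nat \<Rightarrow> (nat \<times> nat) list \<Rightarrow> nat \<Rightarrow> bool" where
  "enumerates M P \<mu> x xs d \<longleftrightarrow>
     (\<exists>k. let c = (step M P ^^ k) (start x \<mu>)
          in halted P c \<and> map snd (trace c) = map Out xs @ [End] \<and>
             successively (\<lambda>t t'. t' \<le> t + d) (0 # map fst (trace c)))"

section \<open>Presentation of a decorated DAG to the machine\<close>

definition fits_register :: "nat \<Rightarrow> nat \<Rightarrow> bool" where
  "fits_register w x \<longleftrightarrow> x < 2 ^ w"

text \<open>The vertex \<open>vs ! j\<close> of a duplicate-free list is represented by the number \<open>j\<close>.\<close>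

definition vertex_no :: "'v list \<Rightarrow> 'v \<Rightarrow> nat" where
  "vertex_no vs v = length (takeWhile (\<lambda>u. u \<noteq> v) vs)"

text \<open>
  The input consists of the numbers of vertices and edges, for every vertex the code
  of the morphism of its empty path, for every vertex whether it is a target, and for
  every edge its two end points and the code of its morphism. Vertices and edges are
  listed in an arbitrary order, in particular not in a topological one.
\<close>

definition input_words ::
    "('o, 'm) category \<Rightarrow> ('v, 'i, 'o, 'm) decorated_graph \<Rightarrow> 'v set \<Rightarrow> ('m \<Rightarrow> nat) \<Rightarrow>
     'v list \<Rightarrow> ('v \<times> 'i \<times> 'v) list \<Rightarrow> nat list" where
  "input_words C D V0 enc vs es =
     [length vs, length es] @
     map (\<lambda>v. enc (path_mor C D (v, []))) vs @
     map (\<lambda>v. if v \<in> V0 then 1 else 0) vs @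
     concat (map (\<lambda>(u, i, v). [vertex_no vs u, vertex_no vs v, enc (edec D (u, i, v))]) es)"

definition memory_of :: "nat list \<Rightarrow> nat \<Rightarrow> nat" where
  "memory_of ws a = (if a < length ws then ws ! a else 0)"

end

theory Submission
  imports Defs
begin

text \<open>
  Preprocessing turns the DAG into a set of nodes, each of which emits exactly one output and has at
  most two continuations. The vertices are processed in reverse topological order. Each vertex
  \<open>u\<close> keeps the first path to a target that was found for it and a continuation that stands for all
  further ones. When an edge \<open>e\<close> from \<open>u\<close> to a completed vertex \<open>v\<close> is processed and no path was
  known for \<open>u\<close>, the data of \<open>v\<close>, composed with \<open>e\<close>, become those of \<open>u\<close>; this also contracts chains
  of vertices that do not branch. Otherwise a node is created for \<open>e\<close> that outputs the first path of
  \<open>v\<close> prefixed with \<open>e\<close>, whose left continuation is that of \<open>v\<close> (through \<open>e\<close>) and whose right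
  continuation is the previous one of \<open>u\<close>, and it becomes the new continuation of \<open>u\<close>.

  The paths from \<open>s\<close> are then the first path of \<open>s\<close> and a preorder traversal of a binary tree with one
  output per node. A stack frame is pushed only if the right continuation is not empty, so each pop
  leads directly to a further output, and all delays are constant.
\<close>

section \<open>Structured programs for the machine\<close>

text \<open>A search of the DAG itself has unbounded delay: it can wander through parts that reach
  no target, follow long stretches without output, and unwind many exhausted frames. Placing an
  output in every tree node, rather than at the leaves, rules this out. Keeping the first path
  outside the tree is what makes one node per edge suffice: when two lists of paths are joined, the
  first path of one of them becomes the output of the node that joins their continuations.

  Nodes are shared by many vertices and the source is unknown during preprocessing, so a node stores
  codes relative to its own vertex, and each reference to it carries the code of the connecting
  path. A bounded number of compositions per output then suffices.

  The proof tracks paths as lists of edge numbers rather than morphisms: composition is specified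
  only along consecutive paths, and different paths may have the same morphism. Multiplicities are
  correct because the underlying list of paths is distinct.\<close>

datatype cmd =
    Skip
  | Prim instr
  | Seq cmd cmd (infixr ";;" 60)
  | IfNZ nat cmd cmd
  | While nat cmd

fun plain :: "instr \<Rightarrow> bool" where
  "plain (Jump l) = False"
| "plain (JumpZero r l) = False"
| "plain Halt = False"
| "plain _ = True"

text \<open>The first argument is the address at which the code will be placed, because the jump
  targets of the machine are absolute.\<close>

fun compile :: "nat \<Rightarrow> cmd \<Rightarrow> instr list" where
  "compile l Skip = []"
| "compile l (Prim i) = [i]"
| "compile l (a ;; b) = compile l a @ compile (l + length (compile l a)) b"
| "compile l (IfNZ r a b) =
     (let A = compile (l + 1) a; B = compile (l + length A + 2) b
      in JumpZero r (l + length A + 2) # A @ Jump (l + length A + 2 + length B) # B)"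
| "compile l (While r a) =
     (let A = compile (l + 1) a in JumpZero r (l + length A + 2) # A @ [Jump l])"

definition tick :: "config \<Rightarrow> config" where
  "tick c = c\<lparr>clock := clock c + 1\<rparr>"

definition sem :: "ram \<Rightarrow> instr \<Rightarrow> config \<Rightarrow> config" where
  "sem M i c = (exec M i c)\<lparr>clock := clock c + instr_time M i\<rparr>"

text \<open>Each \<open>tick\<close> pays for one jump of the compiled code: the test on entering a
  branch or a round of a loop, the jump from the first branch over the second, and the jump back at
  the end of a round.\<close>

inductive bigstep :: "ram \<Rightarrow> cmd \<Rightarrow> config \<Rightarrow> config \<Rightarrow> bool" for M where
  "bigstep M Skip c c"
| "plain i \<Longrightarrow> bigstep M (Prim i) c (sem M i c)"
| "bigstep M a c c' \<Longrightarrow> bigstep M b c' c'' \<Longrightarrow> bigstep M (a ;; b) c c''"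
| "reg c r \<noteq> 0 \<Longrightarrow> bigstep M a (tick c) c' \<Longrightarrow> bigstep M (IfNZ r a b) c (tick c')"
| "reg c r = 0 \<Longrightarrow> bigstep M b (tick c) c' \<Longrightarrow> bigstep M (IfNZ r a b) c c'"
| "reg c r = 0 \<Longrightarrow> bigstep M (While r a) c (tick c)"
| "reg c r \<noteq> 0 \<Longrightarrow> bigstep M a (tick c) c' \<Longrightarrow> bigstep M (While r a) (tick c') c'' \<Longrightarrow>
     bigstep M (While r a) c c''"

text \<open>The program counter of a configuration is irrelevant to \<open>bigstep\<close>, so it is only compared
  up to an update of \<open>pc\<close>.\<close>

definition reaches :: "ram \<Rightarrow> instr list \<Rightarrow> config \<Rightarrow> config \<Rightarrow> bool" where
  "reaches M P c c' \<longleftrightarrow> (\<exists>k. (step M P ^^ k) c = c')"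

lemma reaches_refl: "reaches M P c c"
  unfolding reaches_def by (rule exI[of _ 0]) simp

lemma reaches_trans:
  assumes "reaches M P a b" "reaches M P b c"
  shows "reaches M P a c"
proof -
  obtain k l where "(step M P ^^ k) a = b" "(step M P ^^ l) b = c"
    using assms unfolding reaches_def by blast
  then have "(step M P ^^ (l + k)) a = c" by (simp add: funpow_add)
  then show ?thesis unfolding reaches_def by blast
qed

lemma reaches_step: "step M P c = c' \<Longrightarrow> reaches M P c c'"
  unfolding reaches_def by (rule exI[of _ 1]) simp

lemma step_plain:
  assumes "plain i" "P = pre @ i # post"
  shows "step M P (c\<lparr>pc := length pre\<rparr>) = (sem M i c)\<lparr>pc := length pre + 1\<rparr>"
  using assms
  by (cases i) (auto simp: step_def halted_def sem_def set_reg_def emit_def)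

text \<open>The surrounding code \<open>pre\<close> and \<open>post\<close> has to be arbitrary in
  the induction, since every subcommand sits at its own address in the same program
  \<open>P\<close>. Induction follows the execution rather than the command because a loop runs the
  same command again.\<close>

lemma compile_correct:
  assumes "bigstep M a c c'" "P = pre @ compile (length pre) a @ post"
  shows "reaches M P (c\<lparr>pc := length pre\<rparr>)
           (c'\<lparr>pc := length pre + length (compile (length pre) a)\<rparr>)"
  using assms
proof (induction arbitrary: pre post rule: bigstep.induct)
  case (1 c)
  then show ?case by (simp add: reaches_refl)
next
  case (2 i c)
  then show ?case using step_plain by (auto intro!: reaches_step)
next
  case (3 a c c' b c'')
  let ?A = "compile (length pre) a"
  show ?case
    using 3(3)[of pre "compile (length pre + length ?A) b @ post"] 3(4)[of "pre @ ?A" post] 3(5)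
    by (auto intro: reaches_trans simp: add.assoc)
next
  case (4 c r a c' b)
  let ?A = "compile (length pre + 1) a"
  let ?e = "length pre + length ?A + 2 + length (compile (length pre + length ?A + 2) b)"
  have P: "P = (pre @ [JumpZero r (length pre + length ?A + 2)]) @ ?A @
      (Jump ?e # compile (length pre + length ?A + 2) b @ post)"
    using 4 by (simp add: Let_def)
  have "reaches M P (c\<lparr>pc := length pre\<rparr>) ((tick c)\<lparr>pc := length pre + 1\<rparr>)"
    using 4(1) by (intro reaches_step, subst P)
      (simp add: step_def halted_def nth_append tick_def)
  moreover have "reaches M P ((tick c)\<lparr>pc := length pre + 1\<rparr>)
      (c'\<lparr>pc := length pre + 1 + length ?A\<rparr>)"
    using 4(3)[of "pre @ [JumpZero r (length pre + length ?A + 2)]"] P by simp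
  moreover have "reaches M P (c'\<lparr>pc := length pre + 1 + length ?A\<rparr>) ((tick c')\<lparr>pc := ?e\<rparr>)"
    by (intro reaches_step, subst P)
      (simp add: step_def halted_def nth_append tick_def)
  ultimately show ?case
    by (auto intro: reaches_trans simp: Let_def ac_simps)
next
  case (5 c r b c' a)
  let ?A = "compile (length pre + 1) a"
  let ?B = "compile (length pre + length ?A + 2) b"
  let ?e = "length pre + length ?A + 2 + length ?B"
  let ?pre = "pre @ JumpZero r (length pre + length ?A + 2) # ?A @ [Jump ?e]"
  have P: "P = ?pre @ ?B @ post"
    using 5 by (simp add: Let_def)
  have "reaches M P (c\<lparr>pc := length pre\<rparr>) ((tick c)\<lparr>pc := length pre + length ?A + 2\<rparr>)"
    using 5(1) by (intro reaches_step, subst P)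
      (simp add: step_def halted_def nth_append tick_def)
  moreover have "reaches M P ((tick c)\<lparr>pc := length pre + length ?A + 2\<rparr>) (c'\<lparr>pc := ?e\<rparr>)"
    using 5(3)[of ?pre post] P by simp
  ultimately show ?case
    by (auto intro: reaches_trans simp: Let_def ac_simps)
next
  case (6 c r a)
  let ?A = "compile (length pre + 1) a"
  have P: "P = pre @ JumpZero r (length pre + length ?A + 2) # ?A @ Jump (length pre) # post"
    using 6 by (simp add: Let_def)
  show ?case
    using 6(1) by (intro reaches_step, subst P)
      (simp add: step_def halted_def nth_append tick_def Let_def)
next
  case (7 c r a c' c'')
  let ?A = "compile (length pre + 1) a"
  have P: "P = (pre @ [JumpZero r (length pre + length ?A + 2)]) @ ?A @ Jump (length pre) # post"
    using 7 by (simp add: Let_def)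
  have "reaches M P (c\<lparr>pc := length pre\<rparr>) ((tick c)\<lparr>pc := length pre + 1\<rparr>)"
    using 7(1) by (intro reaches_step, subst P)
      (simp add: step_def halted_def nth_append tick_def)
  moreover have "reaches M P ((tick c)\<lparr>pc := length pre + 1\<rparr>)
      (c'\<lparr>pc := length pre + 1 + length ?A\<rparr>)"
    using 7(4)[of "pre @ [JumpZero r (length pre + length ?A + 2)]"] P by simp
  moreover have "reaches M P (c'\<lparr>pc := length pre + 1 + length ?A\<rparr>)
      ((tick c')\<lparr>pc := length pre\<rparr>)"
    by (intro reaches_step, subst P)
      (simp add: step_def halted_def nth_append tick_def)
  moreover note 7(5)[of pre post, OF 7(6)]
  ultimately show ?case
    by (meson reaches_trans)
qed

section \<open>Total correctness with running times\<close>

definition wp :: "ram \<Rightarrow> cmd \<Rightarrow> (config \<Rightarrow> bool) \<Rightarrow> config \<Rightarrow> bool" where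
  "wp M a Q c \<longleftrightarrow> (\<exists>c'. bigstep M a c c' \<and> Q c')"

lemma wp_Skip: "wp M Skip Q c = Q c"
  by (auto simp: wp_def intro: bigstep.intros elim: bigstep.cases)

lemma wp_Prim: "plain i \<Longrightarrow> wp M (Prim i) Q c = Q (sem M i c)"
  by (auto simp: wp_def intro: bigstep.intros elim: bigstep.cases)

lemma wp_Seq: "wp M (a ;; b) Q c = wp M a (wp M b Q) c"
  unfolding wp_def by (blast intro: bigstep.intros elim: bigstep.cases)

lemma wp_IfNZ:
  "wp M (IfNZ r a b) Q c =
     (if reg c r = 0 then wp M b Q (tick c) else wp M a (\<lambda>c. Q (tick c)) (tick c))"
  unfolding wp_def by (force intro: bigstep.intros elim: bigstep.cases)

lemma wp_mono: "wp M a Q c \<Longrightarrow> (\<And>c'. Q c' \<Longrightarrow> R c') \<Longrightarrow> wp M a R c"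
  unfolding wp_def by blast

text \<open>The ghost value \<open>x\<close> carries what a configuration does not determine by
  itself, such as the list that a chain of references represents or the set of vertices treated so
  far; termination is measured on it.\<close>

lemma wp_While_ghost:
  fixes f :: "'a \<Rightarrow> nat"
  assumes "I x c"
    and body: "\<And>x c. I x c \<Longrightarrow> reg c r \<noteq> 0 \<Longrightarrow> wp M a (\<lambda>c'. \<exists>y. I y (tick c') \<and> f y < f x) (tick c)"
    and exit: "\<And>x c. I x c \<Longrightarrow> reg c r = 0 \<Longrightarrow> Q (tick c)"
  shows "wp M (While r a) Q c"
  using \<open>I x c\<close>
proof (induction "f x" arbitrary: x c rule: less_induct)
  case less
  show ?case
  proof (cases "reg c r = 0")
    case True
    then show ?thesis
      using exit[OF less.prems] unfolding wp_def by (blast intro: bigstep.intros)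
  next
    case False
    then obtain c' y where "bigstep M a (tick c) c'" "I y (tick c')" "f y < f x"
      using body[OF less.prems] unfolding wp_def by blast
    then show ?thesis
      using less.hyps[of y "tick c'"] False unfolding wp_def by (blast intro: bigstep.intros)
  qed
qed

lemma wp_While:
  fixes f :: "config \<Rightarrow> nat"
  assumes "I c"
    and body: "\<And>c. I c \<Longrightarrow> reg c r \<noteq> 0 \<Longrightarrow> wp M a (\<lambda>c'. I (tick c') \<and> f (tick c') < f c) (tick c)"
    and exit: "\<And>c. I c \<Longrightarrow> reg c r = 0 \<Longrightarrow> Q (tick c)"
  shows "wp M (While r a) Q c"
proof (rule wp_While_ghost[where I = "\<lambda>x c. x = c \<and> I c" and x = c and f = f])
  fix x c assume I: "x = c \<and> I c" and "reg c r \<noteq> 0"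
  then show "wp M a (\<lambda>c'. \<exists>y. (y = tick c' \<and> I (tick c')) \<and> f y < f x) (tick c)"
    using body[of c] by (auto elim!: wp_mono)
next
  show "x = c \<and> I c \<Longrightarrow> reg c r = 0 \<Longrightarrow> Q (tick c)" for x c
    by (simp add: exit)
qed (simp add: \<open>I c\<close>)

lemma wp_compile:
  assumes "wp M a Q (start x \<mu>)" "\<And>c p. Q c \<Longrightarrow> Q (c\<lparr>pc := p\<rparr>)"
  shows "\<exists>k. Q ((step M (compile 0 a) ^^ k) (start x \<mu>)) \<and>
             halted (compile 0 a) ((step M (compile 0 a) ^^ k) (start x \<mu>))"
proof -
  obtain c' where c': "bigstep M a (start x \<mu>) c'" "Q c'"
    using assms(1) unfolding wp_def by blast
  have "reaches M (compile 0 a) ((start x \<mu>)\<lparr>pc := 0\<rparr>) (c'\<lparr>pc := length (compile 0 a)\<rparr>)"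
    using compile_correct[OF c'(1), of "compile 0 a" "[]" "[]"] by simp
  moreover have "(start x \<mu>)\<lparr>pc := 0\<rparr> = start x \<mu>"
    by (simp add: start_def)
  ultimately obtain k where
      "(step M (compile 0 a) ^^ k) (start x \<mu>) = c'\<lparr>pc := length (compile 0 a)\<rparr>"
    unfolding reaches_def by auto
  then show ?thesis
    using assms(2)[OF c'(2)] by (intro exI[of _ k]) (simp add: halted_def)
qed

section \<open>Networks and their records in memory\<close>

text \<open>The record size 16 exceeds the number of fields in use and is a power of two, so that
  \<open>index\<close> can multiply by it with four doublings.\<close>

definition cell :: "nat \<Rightarrow> nat \<Rightarrow> nat \<Rightarrow> nat" where
  "cell l i f = l + 16 * i + f"

lemma cell_eq_iff [simp]:
  assumes "f < 16" "g < 16"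
  shows "cell l i f = cell l j g \<longleftrightarrow> i = j \<and> f = g"
proof
  assume "cell l i f = cell l j g"
  then have eq: "16 * i + f = 16 * j + g"
    by (simp add: cell_def)
  have "i = (16 * i + f) div 16" "j = (16 * j + g) div 16"
    using assms by simp_all
  then have "i = j"
    unfolding eq by simp
  then show "i = j \<and> f = g"
    using eq by simp
qed simp

lemma cell_shift [simp]: "cell l i 0 + f = cell l i f" "f + cell l i 0 = cell l i f"
  by (simp_all add: cell_def)

lemma cell_Suc: "cell l i 16 = cell l (Suc i) 0"
  by (simp add: cell_def)

lemma below_cell [simp]: "a < l \<Longrightarrow> a \<noteq> cell l i f"
  by (simp add: cell_def)

definition get :: "nat \<Rightarrow> nat \<Rightarrow> nat \<Rightarrow> cmd" where
  "get r p f = Prim (Const 1 f) ;; Prim (Add 1 p 1) ;; Prim (Load r 1)"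

definition put :: "nat \<Rightarrow> nat \<Rightarrow> nat \<Rightarrow> cmd" where
  "put p f r = Prim (Const 1 f) ;; Prim (Add 1 p 1) ;; Prim (Store 1 r)"

definition index :: "nat \<Rightarrow> cmd" where
  "index r = Prim (Add r r r) ;; Prim (Add r r r) ;; Prim (Add r r r) ;; Prim (Add r r r) ;;
     Prim (Add r r 4)"

text \<open>The first load relies on register 1 being 0 at the start, which is the address of
  \<open>n\<close>. Register 4 receives 2 + 2 * n + 3 * m, the length of the input, where the
  records begin.\<close>

definition preamble :: cmd where
  "preamble =
     Prim (Load 2 1) ;; Prim (Const 5 1) ;; Prim (Load 3 5) ;;
     Prim (Const 4 2) ;; Prim (Add 4 4 2) ;; Prim (Add 4 4 2) ;;
     Prim (Add 4 4 3) ;; Prim (Add 4 4 3) ;; Prim (Add 4 4 3) ;; Prim (Const 10 16)"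

text \<open>Vertices are the numbers below \<open>n\<close> and edges the numbers below \<open>m\<close>; a path is given by
  its first vertex and the list of its edges. \<open>code u p\<close> is the register content that represents
  the morphism of the path \<open>p\<close> from \<open>u\<close>.\<close>

fun chain :: "nat \<Rightarrow> (nat \<Rightarrow> nat) \<Rightarrow> (nat \<Rightarrow> nat) \<Rightarrow> nat \<Rightarrow> nat list \<Rightarrow> bool" where
  "chain m src dst u [] = True"
| "chain m src dst u (j # p) = (j < m \<and> src j = u \<and> chain m src dst (dst j) p)"

fun chain_end :: "(nat \<Rightarrow> nat) \<Rightarrow> nat \<Rightarrow> nat list \<Rightarrow> nat" where
  "chain_end dst u [] = u"
| "chain_end dst u (j # p) = chain_end dst (dst j) p"

text \<open>The category is reduced to the function \<open>code\<close>, with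
  \<open>code_append\<close> as the only law of composition. The factor 64 in \<open>room\<close>
  covers the 2 + 2 * n + 3 * m input words, 16 words per record and the small constants of the
  programs.\<close>

locale network =
  fixes n m :: nat and src dst :: "nat \<Rightarrow> nat" and target :: "nat \<Rightarrow> bool"
    and code :: "nat \<Rightarrow> nat list \<Rightarrow> nat" and M :: ram and \<mu>0 :: "nat \<Rightarrow> nat"
  assumes src_less: "j < m \<Longrightarrow> src j < n"
    and dst_less: "j < m \<Longrightarrow> dst j < n"
    and acyclic_edges: "acyclic {(src j, dst j) | j. j < m}"
    and room: "64 * (n + m + 1) \<le> 2 ^ width M"
    and code_less: "u < n \<Longrightarrow> chain m src dst u p \<Longrightarrow> code u p < 2 ^ width M"
    and code_append: "u < n \<Longrightarrow> chain m src dst u p \<Longrightarrow> chain m src dst (chain_end dst u p) q \<Longrightarrow>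
       comp_op M (code u p) (code (chain_end dst u p) q) = code u (p @ q)"
    and input_n: "\<mu>0 0 = n"
    and input_m: "\<mu>0 1 = m"
    and input_ident: "i < n \<Longrightarrow> \<mu>0 (2 + i) = code i []"
    and input_target: "i < n \<Longrightarrow> \<mu>0 (2 + n + i) = (if target i then 1 else 0)"
    and input_src: "j < m \<Longrightarrow> \<mu>0 (2 + 2 * n + 3 * j) = src j"
    and input_dst: "j < m \<Longrightarrow> \<mu>0 (2 + 2 * n + 3 * j + 1) = dst j"
    and input_code: "j < m \<Longrightarrow> \<mu>0 (2 + 2 * n + 3 * j + 2) = code (src j) [j]"
    and input_zero: "2 + 2 * n + 3 * m \<le> a \<Longrightarrow> \<mu>0 a = 0"
begin

definition "L = 2 + 2 * n + 3 * m"
abbreviation "W \<equiv> (2::nat) ^ width M"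
abbreviation "path \<equiv> chain m src dst"
abbreviation "fin \<equiv> chain_end dst"
abbreviation "\<tau> \<equiv> comp_time M"

text \<open>Record \<open>i < n\<close> belongs to vertex \<open>i\<close> and record \<open>n + j\<close> to edge \<open>j\<close>. The fields are, for a
  vertex: 0 number of unprocessed outgoing edges, 1 first incoming edge, 2 whether a path to a target
  has been found, 3 end of the first such path, 4 its code, 5 and 6 continuation, 8 code
  of the empty path, 9 worklist link; for an edge: 0 source, 1 next edge into the same vertex, 2 code, 3 and 4 output, 5 and 6
  left continuation, 7 and 8 right continuation, 9 and 10 stack frame. References to records are
  addresses of their field 0, and 0 is the null reference. A continuation consists of a reference to
  the record of an edge \<open>j\<close> and the code of a path to \<open>src j\<close>.

  Register 1 is scratch space for addresses, and the registers 2, 3, 4, 5 and 10 hold the constants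
  listed in \<open>ok\<close> below.\<close>

abbreviation fld :: "nat \<Rightarrow> nat \<Rightarrow> nat" where "fld i f \<equiv> cell L i f"

text \<open>Otherwise the addition of the field offset 2 to an address would be rewritten with \<open>Suc\<close>.\<close>

declare add_2_eq_Suc [simp del] add_2_eq_Suc' [simp del]

lemma room': "64 * n + 64 * m + 64 \<le> W"
  using room by simp

lemma width_pos [simp]: "0 < width M"
  using room' by (cases "width M") auto

lemma numeral_less_W [simp]: "numeral k < (64::nat) \<Longrightarrow> numeral k < W"
  by (erule less_le_trans) (use room' in linarith)

lemma fld_less_W [simp]: "i < n + m \<Longrightarrow> f < 16 \<Longrightarrow> fld i f < W"
  using room' unfolding cell_def L_def by linarith

lemma fld_end_less_W [simp]: "i \<le> n + m \<Longrightarrow> fld i 0 < W"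
  using room' unfolding cell_def L_def by linarith

lemma less_W [simp]: "i \<le> n \<Longrightarrow> i < W" "i \<le> m \<Longrightarrow> i < W" "i \<le> L \<Longrightarrow> i < W"
  subgoal using room' by linarith
  subgoal using room' by linarith
  subgoal using room' unfolding L_def by linarith
  done

lemma fld_nonzero [simp]: "fld i f \<noteq> 0" "0 < fld i f"
  by (auto simp: cell_def L_def)

text \<open>Writing to a register reduces modulo \<open>W\<close>, so the bound on all memory words
  is what makes loads exact.\<close>

definition ok :: "config \<Rightarrow> bool" where
  "ok c \<longleftrightarrow> (\<forall>a. mem c a < W) \<and> reg c 2 = n \<and> reg c 3 = m \<and> reg c 4 = L \<and>
     reg c 5 = 1 \<and> reg c 10 = 16"

lemma path_append [simp]: "path u (p @ q) \<longleftrightarrow> path u p \<and> path (fin u p) q"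
  by (induction p arbitrary: u) auto

lemma fin_append [simp]: "fin u (p @ q) = fin (fin u p) q"
  by (induction p arbitrary: u) auto

lemmas wp_basic = wp_Skip wp_Prim wp_Seq wp_IfNZ sem_def tick_def set_reg_def emit_def

section \<open>Symbolic execution of record accesses\<close>

lemma wp_get:
  assumes "reg c p + f < W" "f < 16" "p \<noteq> 1" "\<forall>a. mem c a < W"
  shows "wp M (get r p f) Q c =
    Q (c\<lparr>reg := (reg c)(1 := reg c p + f, r := mem c (reg c p + f)), pc := pc c + 3,
         clock := clock c + 3\<rparr>)"
  using assms less_W(3)[of f]
  by (simp add: get_def wp_basic eval_nat_numeral del: less_W)

lemma wp_put:
  assumes "reg c p + f < W" "f < 16" "p \<noteq> 1" "r \<noteq> 1"
  shows "wp M (put p f r) Q c =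
    Q (c\<lparr>reg := (reg c)(1 := reg c p + f), mem := (mem c)(reg c p + f := reg c r),
         pc := pc c + 3, clock := clock c + 3\<rparr>)"
  using assms
  by (simp add: put_def wp_basic eval_nat_numeral del: less_W)

lemma wp_index:
  assumes "reg c r < n + m" "reg c 4 = L" "r \<noteq> 4"
  shows "wp M (index r) Q c =
    Q (c\<lparr>reg := (reg c)(r := fld (reg c r) 0), pc := pc c + 5, clock := clock c + 5\<rparr>)"
proof -
  define i where "i = reg c r"
  have "16 * i + L < W"
    using assms(1) room' unfolding i_def L_def by linarith
  then have "i + i < W" "i + i + (i + i) < W" "i + i + (i + i) + (i + i + (i + i)) < W"
    "i + i + (i + i) + (i + i + (i + i)) + (i + i + (i + i) + (i + i + (i + i))) < W"
    "i + i + (i + i) + (i + i + (i + i)) + (i + i + (i + i) + (i + i + (i + i))) + L < W"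
    by linarith+
  moreover have "i + i + (i + i) + (i + i + (i + i)) + (i + i + (i + i) + (i + i + (i + i))) + L =
      fld i 0"
    by (simp add: cell_def)
  ultimately show ?thesis
    using assms(2,3) unfolding i_def
    by (simp add: index_def wp_basic del: less_W) (simp add: eval_nat_numeral)
qed

lemmas wp_simps = wp_basic wp_get wp_put wp_index

lemma wp_preamble:
  assumes mem: "\<forall>a. mem c a < W" "mem c 0 = n" "mem c 1 = m" and "reg c 1 = 0"
    and Q: "\<And>c'. ok c' \<Longrightarrow> reg c' 0 = reg c 0 \<Longrightarrow> mem c' = mem c \<Longrightarrow> trace c' = trace c \<Longrightarrow>
      clock c' = clock c + 10 \<Longrightarrow> Q c'"
  shows "wp M preamble Q c"
  unfolding preamble_def using assms(2-4) less_W(3)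
  apply (simp add: wp_basic L_def)
  apply (rule Q)
  using mem(1) by (simp_all add: ok_def L_def)

end

section \<open>Enumeration\<close>

text \<open>Register 6 refers to the current node, register 8 holds the code of the path from the
  source to it, and register 9 is the top of the stack. A frame keeps the code of the path to its
  node; the code leading to the right continuation is composed with it only on popping.\<close>

definition visit :: cmd where
  "visit =
     get 11 6 3 ;; get 12 6 4 ;; Prim (Compose 12 8 12) ;; Prim (Output 11 12) ;;
     get 13 6 7 ;; IfNZ 13 (put 6 9 8 ;; put 6 10 9 ;; Prim (Move 9 6)) Skip ;;
     get 14 6 6 ;; Prim (Compose 8 8 14) ;; get 6 6 5 ;;
     IfNZ 6 Skip
       (IfNZ 9 (get 8 9 9 ;; get 14 9 8 ;; Prim (Compose 8 8 14) ;; get 6 9 7 ;; get 9 9 10) Skip)"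

definition query_cmd :: cmd where
  "query_cmd =
     preamble ;; Prim (Move 7 0) ;; index 7 ;; get 11 7 2 ;;
     IfNZ 11
       (get 12 7 3 ;; get 13 7 4 ;; Prim (Output 12 13) ;; get 6 7 5 ;; get 8 7 6 ;;
        Prim (Const 9 0) ;; While 6 visit)
       Skip ;;
     Prim OutputEnd"

text \<open>The second conjunct is a budget: at most \<open>e\<close> time units have passed since
  the last output, or since time 0 if there was none. It lets bounds on delays be carried from one
  round of a loop to the next.\<close>

definition paced :: "nat \<Rightarrow> nat \<Rightarrow> config \<Rightarrow> bool" where
  "paced d e c \<longleftrightarrow> successively (\<lambda>t t'. t' \<le> t + d) (0 # map fst (trace c)) \<and>
     clock c \<le> last (0 # map fst (trace c)) + e"

lemma paced_output:
  assumes "paced d e c" "trace c' = trace c @ [(t, ev)]" "t \<le> clock c + k" "e + k \<le> d"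
    "clock c' \<le> t + e'"
  shows "paced d e' c'"
  using assms unfolding paced_def
  by (auto simp: successively_append_iff successively_Cons simp flip: append_Cons split: if_splits)

context network
begin

text \<open>\<open>N\<close> is the set of edges for which a node was created, and node \<open>j\<close> stands for the nonempty
  list \<open>G j\<close> of paths from \<open>src j\<close>.\<close>

definition cont :: "nat set \<Rightarrow> (nat \<Rightarrow> nat list list) \<Rightarrow> nat \<Rightarrow> nat \<Rightarrow> nat \<Rightarrow> nat list list \<Rightarrow> bool" where
  "cont N G u a x ps \<longleftrightarrow> a = 0 \<and> ps = [] \<or>
     (\<exists>j p. a = fld (n + j) 0 \<and> j \<in> N \<and> path u p \<and> fin u p = src j \<and> x = code u p \<and>
        ps = map ((@) p) (G j))"

text \<open>Fields 3 to 6 have the same layout in both kinds of record. The record number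
  \<open>i\<close> is therefore separate from the vertex \<open>u\<close> at which the paths begin:
  \<open>i\<close> is \<open>u\<close> for a vertex and \<open>n + j\<close> for the node of edge
  \<open>j\<close>.\<close>

definition entry :: "(nat \<Rightarrow> nat) \<Rightarrow> nat set \<Rightarrow> (nat \<Rightarrow> nat list list) \<Rightarrow> nat \<Rightarrow> nat \<Rightarrow>
    nat list list \<Rightarrow> bool" where
  "entry \<mu> N G u i ps \<longleftrightarrow> (\<exists>p qs. path u p \<and> \<mu> (fld i 3) = fin u p \<and> \<mu> (fld i 4) = code u p \<and>
     cont N G u (\<mu> (fld i 5)) (\<mu> (fld i 6)) qs \<and> ps = p # qs)"

definition node :: "(nat \<Rightarrow> nat) \<Rightarrow> nat set \<Rightarrow> (nat \<Rightarrow> nat list list) \<Rightarrow> nat \<Rightarrow> bool" where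
  "node \<mu> N G j \<longleftrightarrow> j < m \<and> (\<exists>ps qs. entry \<mu> N G (src j) (n + j) ps \<and>
     cont N G (src j) (\<mu> (fld (n + j) 7)) (\<mu> (fld (n + j) 8)) qs \<and> G j = ps @ qs)"

definition vert :: "(nat \<Rightarrow> nat) \<Rightarrow> nat set \<Rightarrow> (nat \<Rightarrow> nat list list) \<Rightarrow> nat \<Rightarrow> nat list list \<Rightarrow> bool" where
  "vert \<mu> N G u ps \<longleftrightarrow> (if \<mu> (fld u 2) = 0 then ps = [] else entry \<mu> N G u u ps)"

text \<open>A stack frame \<open>(j, p, j', q)\<close> stands for the right continuation of node \<open>j\<close>, which leads to
  node \<open>j'\<close> by \<open>q\<close>, after the path \<open>p\<close>. The frame is stored in the record of \<open>j\<close> itself; since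
  \<open>length (G j)\<close> strictly decreases along continuations, \<open>j\<close> is not on the stack twice.\<close>

definition frame :: "(nat \<Rightarrow> nat) \<Rightarrow> nat set \<Rightarrow> (nat \<Rightarrow> nat list list) \<Rightarrow> nat \<Rightarrow>
    nat \<times> nat list \<times> nat \<times> nat list \<Rightarrow> bool" where
  "frame \<mu> N G s = (\<lambda>(j, p, j', q). j \<in> N \<and> j' \<in> N \<and> path s p \<and> fin s p = src j \<and>
     \<mu> (fld (n + j) 7) = fld (n + j') 0 \<and> path (src j) q \<and> fin (src j) q = src j' \<and>
     \<mu> (fld (n + j) 8) = code (src j) q \<and> length (G j') < length (G j))"

definition frame_paths :: "(nat \<Rightarrow> nat list list) \<Rightarrow> nat \<times> nat list \<times> nat \<times> nat list \<Rightarrow>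
    nat list list" where
  "frame_paths G = (\<lambda>(j, p, j', q). map ((@) (p @ q)) (G j'))"

fun linked :: "(nat \<Rightarrow> nat) \<Rightarrow> nat \<Rightarrow> nat \<Rightarrow> (nat \<times> nat list \<times> nat \<times> nat list) list \<Rightarrow> bool" where
  "linked \<mu> s a [] \<longleftrightarrow> a = 0"
| "linked \<mu> s a ((j, p, _) # stk) \<longleftrightarrow> a = fld (n + j) 0 \<and> \<mu> (fld (n + j) 9) = code s p \<and>
     linked \<mu> s (\<mu> (fld (n + j) 10)) stk"

definition stack_ok :: "(nat \<Rightarrow> nat) \<Rightarrow> nat set \<Rightarrow> (nat \<Rightarrow> nat list list) \<Rightarrow> nat \<Rightarrow> config \<Rightarrow> nat \<Rightarrow>
    (nat \<times> nat list \<times> nat \<times> nat list) list \<Rightarrow> bool" where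
  "stack_ok \<mu> N G s c k stk \<longleftrightarrow> linked (mem c) s (reg c 9) stk \<and> (\<forall>f\<in>set stk. frame \<mu> N G s f) \<and>
     sorted_wrt (<) (k # map (\<lambda>f. length (G (fst f))) stk)"

definition remaining :: "(nat \<Rightarrow> nat) \<Rightarrow> nat set \<Rightarrow> (nat \<Rightarrow> nat list list) \<Rightarrow> nat \<Rightarrow> config \<Rightarrow>
    nat list list \<Rightarrow> bool" where
  "remaining \<mu> N G s c rem \<longleftrightarrow> reg c 6 = 0 \<and> rem = [] \<or>
     (\<exists>j p stk. reg c 6 = fld (n + j) 0 \<and> j \<in> N \<and> path s p \<and> fin s p = src j \<and> reg c 8 = code s p \<and>
        stack_ok \<mu> N G s c (length (G j)) stk \<and>
        rem = map ((@) p) (G j) @ concat (map (frame_paths G) stk))"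

text \<open>Enumeration writes only the stack frames in fields 9 and 10, so everything that nodes
  and vertices assert about \<open>\<mu>\<close> remains readable.\<close>

definition same :: "(nat \<Rightarrow> nat) \<Rightarrow> config \<Rightarrow> bool" where
  "same \<mu> c \<longleftrightarrow> (\<forall>i f. f < 9 \<longrightarrow> mem c (fld i f) = \<mu> (fld i f))"

lemma linked_upd:
  assumes "\<forall>f\<in>set stk. fst f \<noteq> j" "g < 16"
  shows "linked (\<mu>(fld (n + j) g := x)) s a stk = linked \<mu> s a stk"
  using assms(1) by (induction \<mu> s a stk rule: linked.induct) (auto simp: assms(2))

lemma remainingI:
  assumes "reg c 6 = fld (n + j) 0" "j \<in> N" "path s p" "fin s p = src j" "reg c 8 = code s p"
    "linked (mem c) s (reg c 9) stk" "\<forall>f\<in>set stk. frame \<mu> N G s f"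
    "sorted_wrt (<) (length (G j) # map (\<lambda>f. length (G (fst f))) stk)"
    "rem = map ((@) p) (G j) @ concat (map (frame_paths G) stk)"
  shows "remaining \<mu> N G s c rem"
  using assms unfolding remaining_def stack_ok_def by blast

definition out :: "nat \<Rightarrow> nat list \<Rightarrow> event" where
  "out s p = Out (fin s p, code s p)"

text \<open>The paths of a node are its own path, then those of its left and those of its right
  continuation. An output thus removes the head of \<open>rem\<close>, and a push only moves the
  boundary between the current node and the stack. If just the right continuation exists, the frame
  pushed is popped again in the same round.\<close>

lemma wp_visit:
  assumes nodes: "\<forall>j\<in>N. node \<mu> N G j" and s: "s < n"
    and c: "ok c" "same \<mu> c" "remaining \<mu> N G s c rem" "reg c 6 \<noteq> 0"
  shows "wp M visit (\<lambda>c'. ok c' \<and> same \<mu> c' \<and> remaining \<mu> N G s c' (tl rem) \<and> rem \<noteq> [] \<and>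
     (\<exists>t. trace c' = trace c @ [(t, out s (hd rem))] \<and> t \<le> clock c + 50 + \<tau> \<and>
        clock c' \<le> t + 50 + 2 * \<tau>)) c"
proof -
  obtain j p stk where cur: "reg c 6 = fld (n + j) 0" "j \<in> N" "path s p" "fin s p = src j"
      "reg c 8 = code s p"
    and stk: "linked (mem c) s (reg c 9) stk" "\<forall>f\<in>set stk. frame \<mu> N G s f"
      "sorted_wrt (<) (length (G j) # map (\<lambda>f. length (G (fst f))) stk)"
    and rem: "rem = map ((@) p) (G j) @ concat (map (frame_paths G) stk)"
    using c(3,4) unfolding remaining_def stack_ok_def by auto
  have j: "j < m" using nodes cur(2) by (auto simp: node_def)
  obtain p0 ps qs where p0: "path (src j) p0" "\<mu> (fld (n + j) 3) = fin (src j) p0"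
      "\<mu> (fld (n + j) 4) = code (src j) p0"
    and ps: "cont N G (src j) (\<mu> (fld (n + j) 5)) (\<mu> (fld (n + j) 6)) ps"
    and qs: "cont N G (src j) (\<mu> (fld (n + j) 7)) (\<mu> (fld (n + j) 8)) qs"
    and Gj: "G j = p0 # ps @ qs"
    using nodes cur(2) unfolding node_def entry_def by fastforce
  have same [simp]: "mem c (fld i f) = \<mu> (fld i f)" if "f < 9" for i f
    using c(2) that by (simp add: same_def)
  have [simp]: "mem c a < W" "reg c 4 = L" for a using c(1) by (auto simp: ok_def)
  have [simp]: "mem c a mod W = mem c a" for a by simp
  have [simp]: "src j < n" using j by (rule src_less)
  have comp: "comp_op M (code s p) (code (src j) q) mod W = code s (p @ q)" if "path (src j) q" for q
    using code_append[OF s cur(3), of q] code_less[OF s, of "p @ q"] that cur by simp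
  \<comment> \<open>All frames on the stack belong to nodes with strictly longer path lists, so the
    frame written into the record of \<open>j\<close> overwrites none of them.\<close>
  have notin: "\<forall>f\<in>set stk. fst f \<noteq> j"
    using stk(3) by auto
  have out: "out s (hd rem) = Out (fin (src j) p0, code s (p @ p0))" "rem \<noteq> []"
    "tl rem = map ((@) p) ps @ map ((@) p) qs @ concat (map (frame_paths G) stk)"
    using rem Gj cur by (simp_all add: out_def)
  note sim = visit_def wp_simps cur comp p0 out j
  have cont_cases: "a = 0 \<and> xs = [] \<or> (\<exists>j' q. a = fld (n + j') 0 \<and> j' \<in> N \<and> j' < m \<and> path (src j) q \<and>
      fin (src j) q = src j' \<and> x = code (src j) q \<and> xs = map ((@) q) (G j'))" if "cont N G (src j) a x xs" for a x xs
    using that nodes unfolding cont_def by (auto simp: node_def)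
  consider "\<mu> (fld (n + j) 5) = 0" "ps = []" | j' q where "\<mu> (fld (n + j) 5) = fld (n + j') 0"
      "j' \<in> N" "j' < m" "path (src j) q" "fin (src j) q = src j'" "\<mu> (fld (n + j) 6) = code (src j) q"
      "ps = map ((@) q) (G j')"
    using cont_cases[OF ps] by metis
  note L = this
  consider "\<mu> (fld (n + j) 7) = 0" "qs = []" | j' q where "\<mu> (fld (n + j) 7) = fld (n + j') 0"
      "j' \<in> N" "j' < m" "path (src j) q" "fin (src j) q = src j'" "\<mu> (fld (n + j) 8) = code (src j) q"
      "qs = map ((@) q) (G j')"
    using cont_cases[OF qs] by metis
  note R = this
  have [simp]: "code s p < W" using code_less[OF s cur(3)] .
  have [simp]: "reg c 9 < W"
    using stk(1,2) nodes by (cases stk) (auto simp: frame_def node_def split: prod.splits)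
  note okc = c(1)[unfolded ok_def]
  show ?thesis
  proof (cases rule: R)
    case 1
    note r = 1
    show ?thesis
    proof (cases rule: L)
      case 1
      show ?thesis
      proof (cases stk)
        case Nil
        then show ?thesis
          using stk by (simp add: sim r 1 ok_def okc same_def remaining_def)
      next
        case (Cons f stk')
        obtain i p' i' q' where f: "f = (i, p', i', q')" by (cases f)
        then have i: "i < m" "i' < m" using stk(2) Cons nodes by (auto simp: frame_def node_def)
        have comp': "comp_op M (code s p') (code (src i) q') mod W = code s (p' @ q')"
          using code_append[OF s, of p' q'] code_less[OF s, of "p' @ q'"] stk(2) Cons f
          by (simp add: frame_def)
        show ?thesis
          using stk Cons i comp' f
          apply (simp add: sim r 1)
          apply (intro conjI remainingI[where j = i' and p = "p' @ q'" and stk = stk'])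
          apply (auto simp: ok_def okc same_def frame_def frame_paths_def)
          done
      qed
    next
      case (2 j1 q1)
      then show ?thesis
        using stk
        apply (simp add: sim r comp)
        apply (intro conjI remainingI[where j = j1 and p = "p @ q1" and stk = stk])
        apply (auto simp: ok_def okc same_def frame_def frame_paths_def cur Gj)
        done
    qed
  next
    case (2 j2 q2)
    note r = 2
    \<comment> \<open>The required decrease is strict because \<open>G j\<close> contains
      \<open>p0\<close> in addition to the paths that come from \<open>j2\<close>.\<close>
    have fr: "frame \<mu> N G s (j, p, j2, q2)"
      using r cur Gj by (simp add: frame_def)
    show ?thesis
    proof (cases rule: L)
      case 1
      show ?thesis
        using stk notin
        apply (simp add: sim r 1)
        apply (intro conjI remainingI[where j = j2 and p = "p @ q2" and stk = stk])
        apply (auto simp: ok_def okc same_def frame_def frame_paths_def linked_upd cur Gj r)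
        done
    next
      case (2 j1 q1)
      then show ?thesis
        using stk notin fr
        apply (simp add: sim r)
        apply (intro conjI remainingI[where j = j1 and p = "p @ q1" and stk = "(j, p, j2, q2) # stk"])
        apply (auto simp: ok_def okc same_def frame_paths_def linked_upd cur Gj r)
        done
    qed
  qed
qed

lemma wp_visit_loop:
  assumes nodes: "\<forall>j\<in>N. node \<mu> N G j" and s: "s < n"
    and c: "ok c" "same \<mu> c" "remaining \<mu> N G s c rem" "paced (200 + 5 * \<tau>) (90 + 3 * \<tau>) c"
  shows "wp M (While 6 visit) (\<lambda>c'. map snd (trace c') = map snd (trace c) @ map (out s) rem \<and>
     paced (200 + 5 * \<tau>) (91 + 3 * \<tau>) c') c"
proof -
  let ?I = "\<lambda>c'. \<exists>rem'. ok c' \<and> same \<mu> c' \<and> remaining \<mu> N G s c' rem' \<and>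
     map snd (trace c') @ map (out s) rem' = map snd (trace c) @ map (out s) rem \<and>
     paced (200 + 5 * \<tau>) (90 + 3 * \<tau>) c'"
  \<comment> \<open>This is the number of outputs still due, and every round produces exactly
    one.\<close>
  let ?f = "\<lambda>c'. length (trace c) + length rem - length (trace c')"
  show ?thesis
  proof (rule wp_While[where I = ?I and f = ?f])
    show "?I c" using c by blast
  next
    fix c' assume "?I c'" "reg c' 6 \<noteq> 0"
    then obtain rem' where c': "ok c'" "same \<mu> c'" "remaining \<mu> N G s c' rem'" "reg c' 6 \<noteq> 0"
        "map snd (trace c') @ map (out s) rem' = map snd (trace c) @ map (out s) rem"
        "paced (200 + 5 * \<tau>) (90 + 3 * \<tau>) c'"
      by blast
    have "ok (tick c')" "same \<mu> (tick c')" "remaining \<mu> N G s (tick c') rem'" "reg (tick c') 6 \<noteq> 0"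
      using c' unfolding ok_def same_def remaining_def stack_ok_def by (simp_all add: tick_def)
    from wp_visit[OF nodes s this]
    show "wp M visit (\<lambda>c'a. ?I (tick c'a) \<and> ?f (tick c'a) < ?f c') (tick c')"
    proof (rule wp_mono, elim conjE exE)
      fix c'' t
      assume c'': "ok c''" "same \<mu> c''" "remaining \<mu> N G s c'' (tl rem')" "rem' \<noteq> []"
        "trace c'' = trace (tick c') @ [(t, out s (hd rem'))]" "t \<le> clock (tick c') + 50 + \<tau>"
        "clock c'' \<le> t + 50 + 2 * \<tau>"
      have "ok (tick c'')" "same \<mu> (tick c'')" "remaining \<mu> N G s (tick c'') (tl rem')"
        using c'' unfolding ok_def same_def remaining_def stack_ok_def by (simp_all add: tick_def)
      moreover have "map snd (trace (tick c'')) @ map (out s) (tl rem') =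
          map snd (trace c) @ map (out s) rem"
        unfolding c'(5)[symmetric] using c''(4,5) by (cases rem') (simp_all add: tick_def)
      \<comment> \<open>The delay bound arises here: at most 90 + 3 * \<tau> units since the
        previous output, and at most 51 + \<tau> until the next one, including the test of the
        loop.\<close>
      moreover have "paced (200 + 5 * \<tau>) (90 + 3 * \<tau>) (tick c'')"
      proof (rule paced_output[OF c'(6)])
        have ck: "clock (tick c') = clock c' + 1" "clock (tick c'') = clock c'' + 1"
          by (simp_all add: tick_def)
        show "t \<le> clock c' + (51 + \<tau>)" "clock (tick c'') \<le> t + (90 + 3 * \<tau>)"
          using c''(6,7) unfolding ck by linarith+
        show "trace (tick c'') = trace c' @ [(t, out s (hd rem'))]"
          using c''(5) by (simp add: tick_def)
      qed linarith
      moreover have "length (trace c') < length (trace c) + length rem"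
        using arg_cong[OF c'(5), of length] c''(4) by (cases rem') simp_all
      then have "?f (tick c'') < ?f c'"
        using c''(5) by (simp add: tick_def)
      ultimately show "?I (tick c'') \<and> ?f (tick c'') < ?f c'"
        by blast
    qed
  next
    fix c' assume "?I c'" "reg c' 6 = 0"
    then show "map snd (trace (tick c')) = map snd (trace c) @ map (out s) rem \<and>
        paced (200 + 5 * \<tau>) (91 + 3 * \<tau>) (tick c')"
      by (auto simp: remaining_def tick_def paced_def)
  qed
qed

lemma cont_remaining:
  assumes "cont N G s (reg c 6) (reg c 8) ps" "reg c 9 = 0"
  shows "remaining \<mu> N G s c ps"
  using assms remainingI[where stk = "[]" and c = c and s = s and rem = ps]
  unfolding cont_def by (auto simp: remaining_def)

lemma wp_query:
  assumes nodes: "\<forall>j\<in>N. node \<mu> N G j" and s: "s < n" and vert: "vert \<mu> N G s ps"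
    and \<mu>: "\<forall>a. \<mu> a < W" "\<mu> 0 = n" "\<mu> 1 = m"
  shows "wp M query_cmd (\<lambda>c. map snd (trace c) = map (out s) ps @ [End] \<and>
     successively (\<lambda>t t'. t' \<le> t + (200 + 5 * \<tau>)) (0 # map fst (trace c))) (start s \<mu>)"
  unfolding query_cmd_def wp_Seq
proof (rule wp_preamble; simp add: start_def \<mu> \<mu>(3)[simplified])
  fix c assume c: "ok c" "reg c 0 = s" "mem c = \<mu>" "trace c = []" "clock c = 10"
  note okc = c(1)[unfolded ok_def]
  show "wp M (Prim (Move 7 0)) (wp M (index 7) (wp M (get 11 7 2) (wp M
      (IfNZ 11 (get 12 7 3 ;; get 13 7 4 ;; Prim (Output 12 13) ;; get 6 7 5 ;; get 8 7 6 ;;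
        Prim (Const 9 0) ;; While 6 visit) Skip) (wp M (Prim OutputEnd)
      (\<lambda>c. map snd (trace c) = map (out s) ps @ [End] \<and>
     successively (\<lambda>t t'. t' \<le> t + (200 + 5 * \<tau>)) (0 # map fst (trace c))))))) c"
  proof (cases "\<mu> (fld s 2) = 0")
    case True
    then show ?thesis
      using s vert okc c by (simp add: wp_simps vert_def)
  next
    case False
    then obtain p qs where p: "path s p" "\<mu> (fld s 3) = fin s p" "\<mu> (fld s 4) = code s p"
      and qs: "cont N G s (\<mu> (fld s 5)) (\<mu> (fld s 6)) qs" "ps = p # qs"
      using vert by (auto simp: vert_def entry_def)
    show ?thesis
      using s okc c False p \<mu>
      apply (simp add: wp_simps)
      apply (rule wp_mono[OF wp_visit_loop[OF nodes s, where rem = qs]])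
      subgoal by (simp add: ok_def)
      subgoal by (simp add: same_def)
      subgoal by (rule cont_remaining) (simp_all add: qs)
      subgoal by (simp add: paced_def successively_Cons)
      subgoal for c'
        using paced_output[of "200 + 5 * \<tau>" "91 + 3 * \<tau>" c'
          "c'\<lparr>trace := trace c' @ [(Suc (clock c'), End)]\<rparr>" "Suc (clock c')" End 1 1]
        by (simp add: wp_simps qs(2) out_def paced_def)
      done
  qed
qed

end

section \<open>Preprocessing\<close>

definition init_verts :: cmd where
  "init_verts =
     Prim (Const 6 0) ;; Prim (Move 7 4) ;; Prim (Const 8 2) ;; Prim (Move 9 2) ;;
     While 9
       (Prim (Load 11 8) ;; Prim (Add 12 8 2) ;; Prim (Load 12 12) ;;
        put 7 2 12 ;; put 7 3 6 ;; put 7 4 11 ;; put 7 8 11 ;;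
        Prim (Add 6 6 5) ;; Prim (Add 8 8 5) ;; Prim (Add 7 7 10) ;; Prim (Sub 9 9 5))"

text \<open>Registers 7 and 8 continue where \<open>init_verts\<close> left them; adding
  \<open>n\<close> to register 8 skips the target flags. Edges are inserted at the head of the list
  of their end point, so these lists are in decreasing order. The out-degree of the source is
  counted in the same pass.\<close>

definition init_edges :: cmd where
  "init_edges =
     Prim (Add 8 8 2) ;; Prim (Move 9 3) ;;
     While 9
       (Prim (Load 11 8) ;; Prim (Add 8 8 5) ;; Prim (Load 12 8) ;; Prim (Add 8 8 5) ;;
        Prim (Load 13 8) ;; Prim (Add 8 8 5) ;; index 11 ;; index 12 ;;
        put 7 0 11 ;; put 7 2 13 ;; get 14 12 1 ;; put 7 1 14 ;; put 12 1 7 ;;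
        get 14 11 0 ;; Prim (Add 14 14 5) ;; put 11 0 14 ;;
        Prim (Add 7 7 10) ;; Prim (Sub 9 9 5))"

definition init_worklist :: cmd where
  "init_worklist =
     Prim (Move 7 4) ;; Prim (Move 9 2) ;; Prim (Const 15 0) ;;
     While 9
       (get 11 7 0 ;; IfNZ 11 Skip (put 7 9 15 ;; Prim (Move 15 7)) ;;
        Prim (Add 7 7 10) ;; Prim (Sub 9 9 5))"

context network
begin

fun in_list :: "(nat \<Rightarrow> nat) \<Rightarrow> nat \<Rightarrow> nat list \<Rightarrow> bool" where
  "in_list \<mu> a [] \<longleftrightarrow> a = 0"
| "in_list \<mu> a (j # js) \<longleftrightarrow> a = fld (n + j) 0 \<and> in_list \<mu> (\<mu> (fld (n + j) 1)) js"

fun worklist :: "(nat \<Rightarrow> nat) \<Rightarrow> nat \<Rightarrow> nat list \<Rightarrow> bool" where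
  "worklist \<mu> a [] \<longleftrightarrow> a = 0"
| "worklist \<mu> a (v # vs) \<longleftrightarrow> a = fld v 0 \<and> worklist \<mu> (\<mu> (fld v 9)) vs"

lemma cell_shift_1 [simp]: "Suc (fld i 0) = fld i (Suc 0)"
  by (simp add: cell_def)

lemma vertex_neq_edge [simp]: "v < n \<Longrightarrow> n + k \<noteq> v" "v < n \<Longrightarrow> v \<noteq> n + k"
  by auto

lemma in_list_cong:
  "(\<And>j. j \<in> set js \<Longrightarrow> \<mu>' (fld (n + j) 1) = \<mu> (fld (n + j) 1)) \<Longrightarrow> in_list \<mu>' a js = in_list \<mu> a js"
  by (induction \<mu> a js rule: in_list.induct) auto

lemma worklist_cong:
  "(\<And>v. v \<in> set vs \<Longrightarrow> \<mu>' (fld v 9) = \<mu> (fld v 9)) \<Longrightarrow> worklist \<mu>' a vs = worklist \<mu> a vs"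
  by (induction \<mu> a vs rule: worklist.induct) auto

text \<open>Field 2 starts as the target flag because the first path known for a target is its empty
  path. At the other vertices fields 3 and 4 have no meaning as long as field 2 is 0. The zeros
  elsewhere are those of the memory beyond the input.\<close>

definition verts_done :: "nat \<Rightarrow> config \<Rightarrow> bool" where
  "verts_done i c \<longleftrightarrow> (\<forall>a. a < L \<longrightarrow> mem c a = \<mu>0 a) \<and>
     (\<forall>k f. f < 16 \<longrightarrow> mem c (fld k f) =
       (if k < i then (if f = 2 then if target k then 1 else 0 else if f = 3 then k
          else if f = 4 \<or> f = 8 then code k [] else 0) else 0))"

lemma fld_0_0: "L = fld 0 0"
  by (simp add: cell_def)

lemma wp_init_verts:
  assumes "ok c" "mem c = \<mu>0"
    and Q: "\<And>c'. ok c' \<Longrightarrow> verts_done n c' \<Longrightarrow> reg c' 7 = fld n 0 \<Longrightarrow> reg c' 8 = 2 + n \<Longrightarrow>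
      clock c' \<le> clock c + 40 * n + 10 \<Longrightarrow> Q c'"
  shows "wp M init_verts Q c"
proof -
  note okc = assms(1)[unfolded ok_def]
  let ?I = "\<lambda>c'. ok c' \<and> (\<exists>i\<le>n. verts_done i c' \<and> reg c' 6 = i \<and> reg c' 7 = fld i 0 \<and>
    reg c' 8 = 2 + i \<and> reg c' 9 = n - i \<and> clock c' \<le> clock c + 40 * i + 6)"
  have zero: "\<mu>0 (fld k f) = 0" for k f
    using input_zero by (simp add: cell_def L_def)
  show ?thesis
    unfolding init_verts_def using okc
    apply (simp add: wp_simps)
    apply (rule wp_While[where I = ?I and f = "\<lambda>c. reg c 9"])
    subgoal
      by (auto simp: ok_def verts_done_def assms(2) zero intro!: fld_0_0)
    subgoal premises prems for c'
      using prems
    proof (elim conjE exE)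
      fix i assume *: "reg c' 9 \<noteq> 0" "ok c'" "i \<le> n" "verts_done i c'" "reg c' 6 = i"
        "reg c' 7 = fld i 0" "reg c' 8 = 2 + i" "reg c' 9 = n - i" "clock c' \<le> clock c + 40 * i + 6"
      then have i: "i < n" by simp
      note ok' = \<open>ok c'\<close>[unfolded ok_def]
      have m: "mem c' (2 + i) = code i []" "mem c' (2 + i + n) = (if target i then 1 else 0)"
        using *(4) i input_ident[OF i] input_target[OF i] by (auto simp: verts_done_def L_def ac_simps)
      have b: "2 + i < W" "2 + i + n < W" "3 + i < W" using i room' by linarith+
      have [simp]: "code i [] < W" using i by (simp add: code_less)
      show ?thesis
        using * i ok' m b
        apply (simp add: wp_simps cell_Suc)
        apply (auto simp: ok_def verts_done_def less_Suc_eq)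
        done
    qed
    subgoal for c'
      by (rule Q) (auto simp: ok_def verts_done_def tick_def)
    done
qed

definition edges_done :: "nat \<Rightarrow> config \<Rightarrow> bool" where
  "edges_done j c \<longleftrightarrow> (\<forall>a. a < L \<longrightarrow> mem c a = \<mu>0 a) \<and>
     (\<forall>k<j. mem c (fld (n + k) 0) = fld (src k) 0 \<and> mem c (fld (n + k) 2) = code (src k) [k]) \<and>
     (\<forall>v<n. mem c (fld v 0) = length (filter (\<lambda>k. src k = v) [0..<j]) \<and>
        in_list (mem c) (mem c (fld v 1)) (rev (filter (\<lambda>k. dst k = v) [0..<j])) \<and>
        mem c (fld v 2) = (if target v then 1 else 0) \<and> mem c (fld v 3) = v \<and>
        mem c (fld v 4) = code v [] \<and> mem c (fld v 5) = 0 \<and> mem c (fld v 8) = code v [])"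

lemma wp_init_edges:
  assumes "ok c" "verts_done n c" "reg c 7 = fld n 0" "reg c 8 = 2 + n"
    and Q: "\<And>c'. ok c' \<Longrightarrow> edges_done m c' \<Longrightarrow> clock c' \<le> clock c + 100 * m + 10 \<Longrightarrow> Q c'"
  shows "wp M init_edges Q c"
proof -
  note okc = assms(1)[unfolded ok_def]
  let ?I = "\<lambda>c'. ok c' \<and> (\<exists>j\<le>m. edges_done j c' \<and> reg c' 7 = fld (n + j) 0 \<and>
    reg c' 8 = 2 + 2 * n + 3 * j \<and> reg c' 9 = m - j \<and> clock c' \<le> clock c + 100 * j + 6)"
  have "2 + n + n < W" using room' by linarith
  then show ?thesis
    unfolding init_edges_def using okc assms(3,4)
    apply (simp add: wp_simps)
    apply (rule wp_While[where I = ?I and f = "\<lambda>c. reg c 9"])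
    subgoal
      using assms(2) by (auto simp: ok_def verts_done_def edges_done_def)
    subgoal premises prems for c'
      using prems
    proof (elim conjE exE)
      fix j assume *: "reg c' 9 \<noteq> 0" "ok c'" "j \<le> m" "edges_done j c'" "reg c' 7 = fld (n + j) 0"
        "reg c' 8 = 2 + 2 * n + 3 * j" "reg c' 9 = m - j" "clock c' \<le> clock c + 100 * j + 6"
      then have j: "j < m" by simp
      note ok' = \<open>ok c'\<close>[unfolded ok_def]
      define A where "A = 2 + 2 * n + 3 * j"
      have A: "2 + 2 * n + 3 * j = A" "A < L" "Suc A < L" "Suc (Suc A) < L"
        using j by (auto simp: L_def A_def)
      have m: "mem c' A = src j" "mem c' (Suc A) = dst j" "mem c' (Suc (Suc A)) = code (src j) [j]"
        using *(4) A input_src[OF j] input_dst[OF j] input_code[OF j] unfolding edges_done_def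
        by (simp_all add: eval_nat_numeral)
      have b: "A < W" "Suc A < W" "Suc (Suc A) < W" "Suc (Suc (Suc A)) < W" "m < W"
        using j room' A_def by linarith+
      have vert: "src j < n" "dst j < n" "code (src j) [j] < W"
        using j by (auto simp: src_less dst_less code_less)
      have len: "length (filter P [0..<j]) \<le> j" for P
        by (metis length_filter_le length_upt diff_zero)
      have deg: "Suc (mem c' (fld (src j) 0)) < W"
        using *(4) vert(1) len[of "\<lambda>k. src k = src j"] j b(5) unfolding edges_done_def by fastforce
      define \<mu>' where "\<mu>' = (mem c')(fld (n + j) 0 := fld (src j) 0,
        fld (n + j) 2 := code (src j) [j], fld (n + j) (Suc 0) := mem c' (fld (dst j) (Suc 0)),
        fld (dst j) (Suc 0) := fld (n + j) 0, fld (src j) 0 := Suc (mem c' (fld (src j) 0)))"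
      \<comment> \<open>The lists built so far run through records of edges below \<open>j\<close>,
        and none of these is among the words written.\<close>
      have in_list: "in_list \<mu>' a (rev (filter P [0..<j])) = in_list (mem c') a (rev (filter P [0..<j]))"
        for a P
        by (rule in_list_cong) (auto simp: \<mu>'_def vert)
      show ?thesis
        using * j ok' vert
        apply (simp add: wp_simps A(1) m b cell_Suc deg flip: \<mu>'_def)
        apply (intro conjI)
        subgoal using deg by (auto simp: ok_def \<mu>'_def)
        subgoal using in_list unfolding edges_done_def
          by (auto simp: \<mu>'_def less_Suc_eq)
        subgoal by (simp add: A_def)
        subgoal by simp
        done
    qed
    subgoal for c'
      by (rule Q) (auto simp: ok_def edges_done_def tick_def)
    done
qed

section \<open>The set of paths represented after some edges, and its growth by one edge\<close>

definition found :: "nat set \<Rightarrow> nat \<Rightarrow> nat list set" where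
  "found X u = {p. path u p \<and> target (fin u p) \<and> (p = [] \<or> hd p \<in> X)}"

text \<open>The main invariant of preprocessing. Distinctness makes every path appear exactly once,
  and \<open>N \<subseteq> X\<close> ensures that the record of an unprocessed edge is not yet in
  use as a node.\<close>

definition indexed :: "(nat \<Rightarrow> nat) \<Rightarrow> nat set \<Rightarrow> nat set \<Rightarrow> (nat \<Rightarrow> nat list list) \<Rightarrow> bool" where
  "indexed \<mu> X N G \<longleftrightarrow> N \<subseteq> X \<and> (\<forall>j\<in>N. node \<mu> N G j) \<and>
     (\<forall>u<n. \<exists>ps. vert \<mu> N G u ps \<and> distinct ps \<and> set ps = found X u)"

lemma cont_mono:
  assumes "cont N G u a x ps" "N \<subseteq> N'" "\<forall>j\<in>N. G' j = G j"
  shows "cont N' G' u a x ps"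
  using assms unfolding cont_def by (metis subsetD)

lemma entry_mono:
  assumes "entry \<mu> N G u i ps" "N \<subseteq> N'" "\<forall>j\<in>N. G' j = G j"
    "\<forall>f. 2 \<le> f \<and> f \<le> 8 \<longrightarrow> \<mu>' (fld i f) = \<mu> (fld i f)"
  shows "entry \<mu>' N' G' u i ps"
  using assms cont_mono[OF _ assms(2,3)] unfolding entry_def by fastforce

lemma node_mono:
  assumes "node \<mu> N G j" "N \<subseteq> N'" "\<forall>j\<in>N. G' j = G j" "j \<in> N"
    "\<forall>f. 2 \<le> f \<and> f \<le> 8 \<longrightarrow> \<mu>' (fld (n + j) f) = \<mu> (fld (n + j) f)"
  shows "node \<mu>' N' G' j"
  using assms(1,3,4,5) entry_mono[OF _ assms(2,3,5)] cont_mono[OF _ assms(2,3)] unfolding node_def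
  by fastforce

lemma vert_mono:
  assumes "vert \<mu> N G u ps" "N \<subseteq> N'" "\<forall>j\<in>N. G' j = G j"
    "\<forall>f. 2 \<le> f \<and> f \<le> 8 \<longrightarrow> \<mu>' (fld u f) = \<mu> (fld u f)"
  shows "vert \<mu>' N' G' u ps"
  using assms(1,4) entry_mono[OF _ assms(2,3,4)] unfolding vert_def by (auto split: if_splits)

lemma indexed_cong:
  assumes "indexed \<mu> X N G" "\<forall>i f. 2 \<le> f \<and> f \<le> 8 \<longrightarrow> \<mu>' (fld i f) = \<mu> (fld i f)"
  shows "indexed \<mu>' X N G"
  using assms(1) assms(2) node_mono[of \<mu> N G _ N G \<mu>'] vert_mono[of \<mu> N G _ _ N G \<mu>']
  unfolding indexed_def by (metis order_refl)

text \<open>In \<open>found\<close> only the first edge of a path is restricted. Behind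
  \<open>e\<close> the restriction holds by itself, because every edge that leaves
  \<open>dst e\<close> already lies in \<open>X\<close>; the new paths are therefore exactly those
  of \<open>dst e\<close> with \<open>e\<close> in front.\<close>

lemma found_insert:
  assumes "e < m" "\<And>j. j < m \<Longrightarrow> src j = dst e \<Longrightarrow> j \<in> X"
  shows "found (insert e X) u = (if u = src e then found X u \<union> (#) e ` found X (dst e) else found X u)"
proof -
  have "p = [] \<or> hd p \<in> X" if "path (dst e) p" for p
    using that assms(2) by (cases p) auto
  then have "q \<in> (#) e ` found X (dst e)" if "path (src e) q" "target (fin (src e) q)" "q \<noteq> []" "hd q = e" for q
    using that by (cases q) (auto simp: found_def)
  moreover have "hd p \<noteq> e" if "path u p" "p \<noteq> []" "u \<noteq> src e" for p
    using that by (cases p) auto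
  ultimately show ?thesis
    using assms(1) by (auto simp: found_def)
qed

lemma comp_edge:
  assumes "e < m" "path (dst e) p"
  shows "comp_op M (code (src e) [e]) (code (dst e) p) mod W = code (src e) (e # p)"
  using assms code_append[of "src e" "[e]" p] code_less[of "src e" "e # p"] by (simp add: src_less)

text \<open>A continuation is moved to the start of \<open>e\<close> without touching its node,
  since the connecting path is stored with the reference. For the null reference the composed word
  is meaningless, and \<open>cont\<close> asks nothing of it.\<close>

lemma cont_edge:
  assumes "cont N G (dst e) a x ps" "e < m"
  shows "cont N G (src e) a (comp_op M (code (src e) [e]) x mod W) (map ((#) e) ps)"
  using assms(1) unfolding cont_def
proof (elim disjE exE conjE)
  fix j p assume "a = fld (n + j) 0" "j \<in> N" "path (dst e) p" "fin (dst e) p = src j"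
    "x = code (dst e) p" "ps = map ((@) p) (G j)"
  then show "a = 0 \<and> map ((#) e) ps = [] \<or> (\<exists>j p. a = fld (n + j) 0 \<and> j \<in> N \<and> path (src e) p \<and>
      fin (src e) p = src j \<and> comp_op M (code (src e) [e]) x mod W = code (src e) p \<and>
      map ((#) e) ps = map ((@) p) (G j))"
    using assms(2) by (intro disjI2 exI[of _ j] exI[of _ "e # p"]) (simp add: comp_edge)
qed simp

text \<open>An unset flag at \<open>dst e\<close> means that no target is reachable from there, so
  \<open>e\<close> begins no path to be listed.\<close>

lemma indexed_skip:
  assumes ix: "indexed \<mu> X N G" and e: "e < m" "\<And>j. j < m \<Longrightarrow> src j = dst e \<Longrightarrow> j \<in> X"
    and "\<mu> (fld (dst e) 2) = 0"
  shows "indexed \<mu> (insert e X) N G"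
proof -
  have "found X (dst e) = {}"
    using ix assms(4) dst_less[OF e(1)] unfolding indexed_def vert_def by force
  then have "found (insert e X) u = found X u" for u
    using found_insert[OF e] by simp
  then show ?thesis
    using ix unfolding indexed_def by auto
qed

text \<open>Nothing was found from \<open>src e\<close> before, so its paths are just those of
  \<open>dst e\<close> with \<open>e\<close> in front. Both vertices share the same nodes, hence
  \<open>N\<close> and \<open>G\<close> do not change.\<close>

lemma indexed_first:
  assumes ix: "indexed \<mu> X N G" and e: "e < m" "\<And>j. j < m \<Longrightarrow> src j = dst e \<Longrightarrow> j \<in> X"
    and flags: "\<mu> (fld (dst e) 2) \<noteq> 0" "\<mu> (fld (src e) 2) = 0"
    and \<mu>': "\<And>i f. i \<noteq> src e \<Longrightarrow> 2 \<le> f \<Longrightarrow> f \<le> 8 \<Longrightarrow> \<mu>' (fld i f) = \<mu> (fld i f)"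
      "\<mu>' (fld (src e) 2) \<noteq> 0" "\<mu>' (fld (src e) 3) = \<mu> (fld (dst e) 3)"
      "\<mu>' (fld (src e) 4) = comp_op M (code (src e) [e]) (\<mu> (fld (dst e) 4)) mod W"
      "\<mu>' (fld (src e) 5) = \<mu> (fld (dst e) 5)"
      "\<mu>' (fld (src e) 6) = comp_op M (code (src e) [e]) (\<mu> (fld (dst e) 6)) mod W"
  shows "indexed \<mu>' (insert e X) N G"
  unfolding indexed_def
proof (intro conjI ballI allI impI)
  show "N \<subseteq> insert e X" using ix by (auto simp: indexed_def)
  fix j assume j: "j \<in> N"
  then have "node \<mu> N G j" using ix by (auto simp: indexed_def)
  then show "node \<mu>' N G j"
    by (rule node_mono) (use j \<mu>'(1) src_less[OF e(1)] in auto)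
next
  fix u assume u: "u < n"
  show "\<exists>ps. vert \<mu>' N G u ps \<and> distinct ps \<and> set ps = found (insert e X) u"
  proof (cases "u = src e")
    case False
    obtain ps where ps: "vert \<mu> N G u ps" "distinct ps" "set ps = found X u"
      using ix u unfolding indexed_def by blast
    have "vert \<mu>' N G u ps"
      using ps(1) by (rule vert_mono) (use \<mu>'(1)[OF False] in auto)
    then show ?thesis using ps found_insert[OF e] False by auto
  next
    case True
    obtain ps where ps: "vert \<mu> N G (dst e) ps" "distinct ps" "set ps = found X (dst e)"
      using ix dst_less[OF e(1)] unfolding indexed_def by blast
    obtain p qs where p: "path (dst e) p" "\<mu> (fld (dst e) 3) = fin (dst e) p"
        "\<mu> (fld (dst e) 4) = code (dst e) p"
        "cont N G (dst e) (\<mu> (fld (dst e) 5)) (\<mu> (fld (dst e) 6)) qs" "ps = p # qs"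
      using ps(1) flags(1) unfolding vert_def entry_def by auto
    have "entry \<mu>' N G (src e) (src e) (map ((#) e) ps)"
      unfolding entry_def
      by (intro exI[of _ "e # p"] exI[of _ "map ((#) e) qs"])
        (simp add: \<mu>' p e comp_edge cont_edge)
    moreover have "found X u = {}"
      using ix u flags(2) True unfolding indexed_def vert_def by force
    ultimately show ?thesis
      using True ps found_insert[OF e] \<mu>'(2)
      by (intro exI[of _ "map ((#) e) ps"]) (simp add: vert_def distinct_map)
  qed
qed

lemma indexed_node:
  assumes ix: "indexed \<mu> X N G" and e: "e < m" "\<And>j. j < m \<Longrightarrow> src j = dst e \<Longrightarrow> j \<in> X" and "e \<notin> X"
    and flags: "\<mu> (fld (dst e) 2) \<noteq> 0" "\<mu> (fld (src e) 2) \<noteq> 0"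
    and \<mu>': "\<And>i f. i \<noteq> src e \<Longrightarrow> i \<noteq> n + e \<Longrightarrow> 2 \<le> f \<Longrightarrow> f \<le> 8 \<Longrightarrow> \<mu>' (fld i f) = \<mu> (fld i f)"
      "\<mu>' (fld (src e) 2) = \<mu> (fld (src e) 2)" "\<mu>' (fld (src e) 3) = \<mu> (fld (src e) 3)"
      "\<mu>' (fld (src e) 4) = \<mu> (fld (src e) 4)" "\<mu>' (fld (src e) 5) = fld (n + e) 0"
      "\<mu>' (fld (src e) 6) = code (src e) []"
      "\<mu>' (fld (n + e) 3) = \<mu> (fld (dst e) 3)"
      "\<mu>' (fld (n + e) 4) = comp_op M (code (src e) [e]) (\<mu> (fld (dst e) 4)) mod W"
      "\<mu>' (fld (n + e) 5) = \<mu> (fld (dst e) 5)"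
      "\<mu>' (fld (n + e) 6) = comp_op M (code (src e) [e]) (\<mu> (fld (dst e) 6)) mod W"
      "\<mu>' (fld (n + e) 7) = \<mu> (fld (src e) 5)" "\<mu>' (fld (n + e) 8) = \<mu> (fld (src e) 6)"
  shows "\<exists>N G. indexed \<mu>' (insert e X) N G"
proof -
  have eN: "e \<notin> N" using ix assms(4) by (auto simp: indexed_def)
  obtain ps where ps: "vert \<mu> N G (dst e) ps" "distinct ps" "set ps = found X (dst e)"
    using ix dst_less[OF e(1)] unfolding indexed_def by blast
  obtain p qs where p: "path (dst e) p" "\<mu> (fld (dst e) 3) = fin (dst e) p"
      "\<mu> (fld (dst e) 4) = code (dst e) p"
      "cont N G (dst e) (\<mu> (fld (dst e) 5)) (\<mu> (fld (dst e) 6)) qs" "ps = p # qs"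
    using ps(1) flags(1) unfolding vert_def entry_def by auto
  obtain ps1 where ps1: "vert \<mu> N G (src e) ps1" "distinct ps1" "set ps1 = found X (src e)"
    using ix src_less[OF e(1)] unfolding indexed_def by blast
  obtain p1 qs1 where p1: "path (src e) p1" "\<mu> (fld (src e) 3) = fin (src e) p1"
      "\<mu> (fld (src e) 4) = code (src e) p1"
      "cont N G (src e) (\<mu> (fld (src e) 5)) (\<mu> (fld (src e) 6)) qs1" "ps1 = p1 # qs1"
    using ps1(1) flags(2) unfolding vert_def entry_def by auto
  \<comment> \<open>All paths now found from \<open>src e\<close> except \<open>p1\<close>, which
    remains in the vertex record.\<close>
  define gl where "gl = map ((#) e) ps @ qs1"
  define G' where "G' = G(e := gl)"
  define N' where "N' = insert e N"
  have NG: "N \<subseteq> N'" "\<forall>j\<in>N. G' j = G j" using eN by (auto simp: N'_def G'_def)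
  note mono = cont_mono[OF _ NG]
  have "indexed \<mu>' (insert e X) N' G'"
    unfolding indexed_def
  proof (intro conjI ballI allI impI)
    show "N' \<subseteq> insert e X" using ix by (auto simp: indexed_def N'_def)
    fix j assume j: "j \<in> N'"
    show "node \<mu>' N' G' j"
    proof (cases "j = e")
      case False
      then have "j \<in> N" "node \<mu> N G j" using ix j by (auto simp: indexed_def N'_def)
      then show ?thesis
        using node_mono[OF _ NG] \<mu>'(1) src_less[OF e(1)] False by simp
    next
      case True
      have "entry \<mu>' N' G' (src e) (n + e) (map ((#) e) ps)"
        unfolding entry_def
        by (intro exI[of _ "e # p"] exI[of _ "map ((#) e) qs"])
          (simp add: \<mu>' p e comp_edge mono[OF cont_edge])
      moreover have "cont N' G' (src e) (\<mu>' (fld (n + e) 7)) (\<mu>' (fld (n + e) 8)) qs1"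
        using mono[OF p1(4)] \<mu>' by simp
      ultimately show ?thesis
        using True e unfolding node_def by (auto simp: G'_def gl_def)
    qed
  next
    fix u assume u: "u < n"
    show "\<exists>ps. vert \<mu>' N' G' u ps \<and> distinct ps \<and> set ps = found (insert e X) u"
    proof (cases "u = src e")
      case False
      obtain ps where ps: "vert \<mu> N G u ps" "distinct ps" "set ps = found X u"
        using ix u unfolding indexed_def by blast
      have "vert \<mu>' N' G' u ps"
        using ps(1) NG by (rule vert_mono) (use \<mu>'(1)[OF False] u in auto)
      then show ?thesis using ps found_insert[OF e] False by auto
    next
      case True
      \<comment> \<open>The new node belongs to \<open>src e\<close> itself, so it is reached by the
        empty path; this is why field 6 receives the code of \<open>[]\<close>.\<close>
      have "vert \<mu>' N' G' (src e) (p1 # gl)"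
        unfolding vert_def entry_def cont_def using \<mu>' flags(2) p1
        by (auto simp: N'_def G'_def map_idI intro!: exI[of _ p1] exI[of _ e] exI[of _ "[]"])
      \<comment> \<open>New paths begin with \<open>e\<close>, whereas the old ones are empty or
        begin with an edge of \<open>X\<close>, which does not contain \<open>e\<close>.\<close>
      moreover have "(#) e ` set ps \<inter> set ps1 = {}"
        using ps1(3) assms(4) by (auto simp: found_def)
      then have "distinct (p1 # gl)"
        using ps ps1 p1(5) by (auto simp: gl_def distinct_map)
      moreover have "set (p1 # gl) = found (insert e X) u"
        using True found_insert[OF e] ps(3) ps1(3) p1(5) by (auto simp: gl_def)
      ultimately show ?thesis using True by blast
    qed
  qed
  then show ?thesis by blast
qed

end

section \<open>Reverse topological sorting, starting from the sinks and counting out-degrees\<close>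

definition link_edge :: cmd where
  "link_edge =
     get 9 8 0 ;; get 11 6 2 ;;
     IfNZ 11
       (get 12 6 3 ;; get 13 8 2 ;; get 14 6 4 ;; Prim (Compose 14 13 14) ;;
        get 16 6 5 ;; get 17 6 6 ;; Prim (Compose 17 13 17) ;; get 11 9 2 ;;
        IfNZ 11
          (put 8 3 12 ;; put 8 4 14 ;; put 8 5 16 ;; put 8 6 17 ;; get 12 9 5 ;; put 8 7 12 ;;
           get 12 9 6 ;; put 8 8 12 ;; put 9 5 8 ;; get 12 9 8 ;; put 9 6 12)
          (put 9 2 5 ;; put 9 3 12 ;; put 9 4 14 ;; put 9 5 16 ;; put 9 6 17))
       Skip"

definition sort_step :: cmd where
  "sort_step =
     link_edge ;; get 11 9 0 ;; Prim (Sub 11 11 5) ;; put 9 0 11 ;;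
     IfNZ 11 Skip (put 9 9 15 ;; Prim (Move 15 9)) ;; get 8 8 1"

definition sort_loop :: cmd where
  "sort_loop =
     While 15 (Prim (Move 6 15) ;; get 15 6 9 ;; get 8 6 1 ;; While 8 sort_step)"

definition prep_cmd :: cmd where
  "prep_cmd = preamble ;; init_verts ;; init_edges ;; init_worklist ;; sort_loop"

context network
begin

definition static :: "(nat \<Rightarrow> nat) \<Rightarrow> bool" where
  "static \<mu> \<longleftrightarrow> \<mu> 0 = n \<and> \<mu> 1 = m \<and>
     (\<forall>j<m. \<mu> (fld (n + j) 0) = fld (src j) 0 \<and> \<mu> (fld (n + j) 2) = code (src j) [j]) \<and>
     (\<forall>v<n. \<mu> (fld v 8) = code v [] \<and>
        in_list \<mu> (\<mu> (fld v 1)) (rev (filter (\<lambda>k. dst k = v) [0..<m])))"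

lemma static_cong:
  assumes "static \<mu>" "\<mu>' 0 = \<mu> 0" "\<mu>' (Suc 0) = \<mu> (Suc 0)"
    "\<forall>j. \<mu>' (fld (n + j) 0) = \<mu> (fld (n + j) 0)"
    "\<forall>j. \<mu>' (fld (n + j) (Suc 0)) = \<mu> (fld (n + j) (Suc 0))"
    "\<forall>j. \<mu>' (fld (n + j) 2) = \<mu> (fld (n + j) 2)"
    "\<forall>v<n. \<mu>' (fld v (Suc 0)) = \<mu> (fld v (Suc 0))" "\<forall>v<n. \<mu>' (fld v 8) = \<mu> (fld v 8)"
  shows "static \<mu>'"
  using assms in_list_cong[of _ \<mu>' \<mu>] unfolding static_def by simp

lemma L_pos [simp]: "0 < L" "Suc 0 < L"
  by (auto simp: L_def)

lemma fld_vertex_less_W [simp]: "v < n \<Longrightarrow> f < 16 \<Longrightarrow> fld v f < W"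
  by simp

text \<open>The flags of the two end points select one of \<open>indexed_skip\<close>,
  \<open>indexed_first\<close> and \<open>indexed_node\<close>. Fields 0, 1 and 9 are framed because
  the sorting keeps its degrees and linked lists there.\<close>

lemma wp_link_edge:
  assumes c: "ok c" "static (mem c)" "indexed (mem c) X N G" "reg c 8 = fld (n + e) 0"
      "reg c 6 = fld (dst e) 0"
    and e: "e < m" "\<And>j. j < m \<Longrightarrow> src j = dst e \<Longrightarrow> j \<in> X" "e \<notin> X"
  shows "wp M link_edge (\<lambda>c'. ok c' \<and> static (mem c') \<and> (\<exists>N G. indexed (mem c') (insert e X) N G) \<and>
     reg c' 6 = reg c 6 \<and> reg c' 8 = reg c 8 \<and> reg c' 15 = reg c 15 \<and> reg c' 9 = fld (src e) 0 \<and>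
     (\<forall>i f. f < 16 \<longrightarrow> f < 2 \<or> f = 9 \<longrightarrow> mem c' (fld i f) = mem c (fld i f)) \<and>
     clock c' \<le> clock c + 100 + 2 * \<tau>) c"
proof -
  note okc = c(1)[unfolded ok_def]
  have [simp]: "src e < n" "dst e < n" using e(1) by (simp_all add: src_less dst_less)
  \<comment> \<open>A loop would be an edge leaving \<open>dst e\<close> and so lie in
    \<open>X\<close>. Hence writing to the source does not disturb the data of the end
    point.\<close>
  have neq: "src e \<noteq> dst e" using e by blast
  have m: "mem c (fld (n + e) 0) = fld (src e) 0" "mem c (fld (n + e) 2) = code (src e) [e]"
      "mem c (fld (src e) 8) = code (src e) []"
    using c(2) e(1) by (simp_all add: static_def)
  have [simp]: "code (src e) [] < W" "code (src e) [e] < W" using e(1) by (simp_all add: code_less)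
  show ?thesis
  proof (cases "mem c (fld (dst e) 2) = 0")
    case True
    then show ?thesis
      unfolding link_edge_def using c okc e indexed_skip[OF c(3) e(1,2) True]
      apply (simp add: wp_simps m)
      apply (auto simp: ok_def)
      done
  next
    case False
    note flag = this
    show ?thesis
    proof (cases "mem c (fld (src e) 2) = 0")
      case True
      show ?thesis
        unfolding link_edge_def using c(1,4,5) okc e(1) flag True
        apply (simp add: wp_simps m)
        apply (intro conjI)
        subgoal by (auto simp: ok_def)
        subgoal by (rule static_cong[OF c(2)]) auto
        subgoal
          by (intro exI, rule indexed_first[OF c(3) e(1,2) flag True]) (auto simp: neq)
        done
    next
      case False
      show ?thesis
        unfolding link_edge_def using c(1,4,5) okc e(1) flag False
        apply (simp add: wp_simps m)
        apply (intro conjI)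
        subgoal by (auto simp: ok_def)
        subgoal by (rule static_cong[OF c(2)]) auto
        subgoal
          by (rule indexed_node[OF c(3) e flag False]) (auto simp: neq)
        done
    qed
  qed
qed

text \<open>\<open>X\<close> is the set of processed edges and \<open>V\<close> the set of vertices taken from the worklist \<open>vs\<close>.\<close>

definition sorted_part :: "nat set \<Rightarrow> nat set \<Rightarrow> nat list \<Rightarrow> config \<Rightarrow> bool" where
  "sorted_part X V vs c \<longleftrightarrow> ok c \<and> static (mem c) \<and> (\<exists>N G. indexed (mem c) X N G) \<and>
     (\<forall>u<n. mem c (fld u 0) = card {j. j < m \<and> src j = u \<and> j \<notin> X}) \<and>
     worklist (mem c) (reg c 15) vs \<and> distinct vs \<and>
     set vs = {u. u < n \<and> u \<notin> V \<and> (\<forall>j<m. src j = u \<longrightarrow> j \<in> X)} \<and>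
     V \<subseteq> {..<n} \<and> X \<subseteq> {..<m} \<and> (\<forall>j<m. src j \<in> V \<longrightarrow> j \<in> X)"

lemma wp_sort_step:
  assumes c: "sorted_part X V vs c" "reg c 6 = fld p 0" "in_list (mem c) (reg c 8) (e # js)"
    and e: "e < m" "dst e = p" "e \<notin> X" and p: "p \<in> V"
  shows "wp M sort_step (\<lambda>c'. (\<exists>vs. sorted_part (insert e X) V vs c') \<and> reg c' 6 = fld p 0 \<and>
     in_list (mem c') (reg c' 8) js \<and> clock c' \<le> clock c + 200 + 2 * \<tau>) c"
proof -
  obtain N G where ix: "indexed (mem c) X N G" and ok: "ok c" "static (mem c)"
    and deg: "\<forall>u<n. mem c (fld u 0) = card {j. j < m \<and> src j = u \<and> j \<notin> X}"
    and vs: "worklist (mem c) (reg c 15) vs" "distinct vs"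
      "set vs = {u. u < n \<and> u \<notin> V \<and> (\<forall>j<m. src j = u \<longrightarrow> j \<in> X)}"
    and X: "V \<subseteq> {..<n}" "X \<subseteq> {..<m}" "\<forall>j<m. src j \<in> V \<longrightarrow> j \<in> X"
    using c(1) unfolding sorted_part_def by blast
  let ?u = "src e"
  have u: "?u < n" using e(1) by (rule src_less)
  have 8: "reg c 8 = fld (n + e) 0" and js: "in_list (mem c) (mem c (fld (n + e) 1)) js"
    using c(3) by simp_all
  \<comment> \<open>Vertices of \<open>V\<close> have only processed outgoing edges, and
    \<open>e\<close> is unprocessed; the source can thus still enter the worklist.\<close>
  have uV: "?u \<notin> V" using X(3) e by blast
  have u_notin: "?u \<notin> set vs" using vs(3) e by blast
  have Suc_deg: "card {j. j < m \<and> src j = ?u \<and> j \<notin> X} = Suc (card {j. j < m \<and> src j = ?u \<and> j \<notin> insert e X})"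
  proof -
    have "{j. j < m \<and> src j = ?u \<and> j \<notin> X} = insert e {j. j < m \<and> src j = ?u \<and> j \<notin> insert e X}"
      using e by auto
    then show ?thesis by simp
  qed
  have deg': "card {j. j < m \<and> src j = v \<and> j \<notin> insert e X} = card {j. j < m \<and> src j = v \<and> j \<notin> X}"
    if "v \<noteq> ?u" for v
    using that by (intro arg_cong[where f = card]) auto
  define d where "d = card {j. j < m \<and> src j = ?u \<and> j \<notin> insert e X}"
  have d0: "d = 0 \<longleftrightarrow> (\<forall>j<m. src j = ?u \<longrightarrow> j \<in> insert e X)"
    unfolding d_def by (subst card_0_eq) auto
  have step: "wp M link_edge (\<lambda>c'. ok c' \<and> static (mem c') \<and> (\<exists>N G. indexed (mem c') (insert e X) N G) \<and>
     reg c' 6 = reg c 6 \<and> reg c' 8 = reg c 8 \<and> reg c' 15 = reg c 15 \<and> reg c' 9 = fld (src e) 0 \<and>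
     (\<forall>i f. f < 16 \<longrightarrow> f < 2 \<or> f = 9 \<longrightarrow> mem c' (fld i f) = mem c (fld i f)) \<and>
     clock c' \<le> clock c + 100 + 2 * \<tau>) c"
    by (rule wp_link_edge[OF ok ix 8]) (use c(2) e p X(3) in auto)
  show ?thesis
    unfolding sort_step_def wp_Seq[of M link_edge]
  proof (rule wp_mono[OF step], elim conjE exE)
    fix c' N' G'
    assume c': "ok c'" "static (mem c')" "indexed (mem c') (insert e X) N' G'" "reg c' 6 = reg c 6"
      "reg c' 8 = reg c 8" "reg c' 15 = reg c 15" "reg c' 9 = fld ?u 0"
      "\<forall>i f. f < 16 \<longrightarrow> f < 2 \<or> f = 9 \<longrightarrow> mem c' (fld i f) = mem c (fld i f)"
      "clock c' \<le> clock c + 100 + 2 * \<tau>"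
    note ok' = c'(1)[unfolded ok_def]
    have same: "mem c' (fld i 0) = mem c (fld i 0)" "mem c' (fld i (Suc 0)) = mem c (fld i (Suc 0))"
      "mem c' (fld i 9) = mem c (fld i 9)" for i
      using c'(8)[rule_format, of 0 i] c'(8)[rule_format, of 1 i] c'(8)[rule_format, of 9 i]
      by simp_all
    have Sd: "mem c' (fld ?u 0) = Suc d"
      using same(1) deg u Suc_deg d_def by simp
    have dW: "Suc d < W"
      using ok'[THEN conjunct1, rule_format, of "fld ?u 0"] Sd by simp
    have js': "in_list \<mu>' (mem c (fld (n + e) (Suc 0))) js" if "\<forall>i. \<mu>' (fld i (Suc 0)) = mem c (fld i (Suc 0))" for \<mu>'
      using js in_list_cong[of js \<mu>' "mem c"] that by simp
    have vs': "worklist \<mu>' (reg c 15) vs" if H: "\<forall>i. i \<noteq> ?u \<longrightarrow> \<mu>' (fld i 9) = mem c (fld i 9)" for \<mu>'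
          proof -
      have "\<mu>' (fld v 9) = mem c (fld v 9)" if "v \<in> set vs" for v
        using H that u_notin by (cases "v = ?u") simp_all
      then show ?thesis using vs(1) worklist_cong[of vs \<mu>' "mem c"] by blast
    qed
    have deg'': "\<forall>v<n. \<mu>' (fld v 0) = card {j. j < m \<and> src j = v \<and> j \<notin> insert e X}"
      if "\<mu>' (fld ?u 0) = d" "\<forall>i. i \<noteq> ?u \<longrightarrow> \<mu>' (fld i 0) = mem c (fld i 0)" for \<mu>'
    proof (intro allI impI)
      fix v assume "v < n"
      then show "\<mu>' (fld v 0) = card {j. j < m \<and> src j = v \<and> j \<notin> insert e X}"
        using that deg deg'[of v] by (cases "v = ?u") (simp_all add: d_def)
    qed
    show "wp M (get 11 9 0 ;; Prim (Sub 11 11 5) ;; put 9 0 11 ;;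
        IfNZ 11 Skip (put 9 9 15 ;; Prim (Move 15 9)) ;; get 8 8 1)
      (\<lambda>c'. (\<exists>vs. sorted_part (insert e X) V vs c') \<and> reg c' 6 = fld p 0 \<and>
         in_list (mem c') (reg c' 8) js \<and> clock c' \<le> clock c + 200 + 2 * \<tau>) c'"
    proof (cases "d = 0")
      case True
      have "static ((mem c')(fld ?u 0 := 0, fld ?u 9 := reg c 15))"
        by (rule static_cong[OF c'(2)]) (use u in auto)
      moreover have "\<exists>N G. indexed ((mem c')(fld ?u 0 := 0, fld ?u 9 := reg c 15)) (insert e X) N G"
        by (intro exI, rule indexed_cong[OF c'(3)]) auto
      moreover have "worklist ((mem c')(fld ?u 0 := 0, fld ?u 9 := reg c 15)) (fld ?u 0) (?u # vs)"
        using vs' by (simp add: same)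
      moreover have "set (?u # vs) =
          {v. v < n \<and> v \<notin> V \<and> (\<forall>j<m. src j = v \<longrightarrow> j \<in> insert e X)}"
        using True d0 u uV unfolding list.set(2) vs(3) by blast
      moreover have "\<forall>v<n. ((mem c')(fld ?u 0 := 0, fld ?u 9 := reg c 15)) (fld v 0) =
          card {j. j < m \<and> src j = v \<and> j \<notin> insert e X}"
        by (rule deg'') (simp_all add: True same)
      moreover have "\<forall>j<m. src j \<in> V \<longrightarrow> j \<in> insert e X"
        using X(3) by blast
      moreover have "in_list ((mem c')(fld ?u 0 := 0, fld ?u 9 := reg c 15))
          (mem c (fld (n + e) (Suc 0))) js"
        by (rule js') (simp add: same)
      ultimately have concl: "(\<exists>vs. sorted_part (insert e X) V vs c'') \<and> in_list (mem c'') (reg c'' 8) js"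
        if "ok c''" "mem c'' = (mem c')(fld ?u 0 := 0, fld ?u 9 := reg c 15)"
          "reg c'' 8 = mem c (fld (n + e) (Suc 0))" "reg c'' 15 = fld ?u 0" for c''
        using that e(1) X(1,2) vs(2) u_notin unfolding sorted_part_def
        by (intro conjI exI[of _ "?u # vs"]) simp_all
      have "\<forall>v\<in>set vs. v < n" using vs(3) by blast
      then have "reg c 15 < W"
        using vs(1) by (cases vs) simp_all
      then have "wp M (get 11 9 0 ;; Prim (Sub 11 11 5) ;; put 9 0 11 ;;
          IfNZ 11 Skip (put 9 9 15 ;; Prim (Move 15 9)) ;; get 8 8 1)
        (\<lambda>c''. ok c'' \<and> mem c'' = (mem c')(fld ?u 0 := 0, fld ?u 9 := reg c 15) \<and>
          reg c'' 8 = mem c (fld (n + e) (Suc 0)) \<and> reg c'' 15 = fld ?u 0 \<and> reg c'' 6 = fld p 0 \<and>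
          clock c'' \<le> clock c + 200 + 2 * \<tau>) c'"
        using c'(7) ok' u e(1) 8 c'(5,6) Sd dW True c'(9) c'(4) c(2)
        by (simp add: wp_simps same ok_def)
      then show ?thesis
        by (rule wp_mono) (use concl in blast)
    next
      case False
      have "static ((mem c')(fld ?u 0 := d))"
        by (rule static_cong[OF c'(2)]) (use u in auto)
      moreover have "\<exists>N G. indexed ((mem c')(fld ?u 0 := d)) (insert e X) N G"
        by (intro exI, rule indexed_cong[OF c'(3)]) auto
      moreover have "worklist ((mem c')(fld ?u 0 := d)) (reg c 15) vs"
        using vs' by (simp add: same)
      moreover have "set vs =
          {v. v < n \<and> v \<notin> V \<and> (\<forall>j<m. src j = v \<longrightarrow> j \<in> insert e X)}"
        using False d0 unfolding vs(3) by blast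
      moreover have "\<forall>v<n. ((mem c')(fld ?u 0 := d)) (fld v 0) =
          card {j. j < m \<and> src j = v \<and> j \<notin> insert e X}"
        by (rule deg'') (simp_all add: same)
      moreover have "\<forall>j<m. src j \<in> V \<longrightarrow> j \<in> insert e X"
        using X(3) by blast
      moreover have "in_list ((mem c')(fld ?u 0 := d)) (mem c (fld (n + e) (Suc 0))) js"
        by (rule js') (simp add: same)
      ultimately have concl: "(\<exists>vs. sorted_part (insert e X) V vs c'') \<and> in_list (mem c'') (reg c'' 8) js"
        if "ok c''" "mem c'' = (mem c')(fld ?u 0 := d)"
          "reg c'' 8 = mem c (fld (n + e) (Suc 0))" "reg c'' 15 = reg c 15" for c''
        using that e(1) X(1,2) vs(2) unfolding sorted_part_def
        by (intro conjI exI[of _ vs]) simp_all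
      have "wp M (get 11 9 0 ;; Prim (Sub 11 11 5) ;; put 9 0 11 ;;
          IfNZ 11 Skip (put 9 9 15 ;; Prim (Move 15 9)) ;; get 8 8 1)
        (\<lambda>c''. ok c'' \<and> mem c'' = (mem c')(fld ?u 0 := d) \<and>
          reg c'' 8 = mem c (fld (n + e) (Suc 0)) \<and> reg c'' 15 = reg c 15 \<and> reg c'' 6 = fld p 0 \<and>
          clock c'' \<le> clock c + 200 + 2 * \<tau>) c'"
        using c'(7) ok' u e(1) 8 c'(5,6) Sd dW c'(9) c'(4) c(2)
        apply (simp add: wp_simps same ok_def False)
        apply (simp add: same)
        done
      then show ?thesis
        by (rule wp_mono) (use concl in blast)
    qed
  qed
qed

lemma tick_simps [simp]: "reg (tick c) = reg c" "mem (tick c) = mem c" "trace (tick c) = trace c"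
  "clock (tick c) = clock c + 1"
  by (simp_all add: tick_def)

lemma sorted_part_tick [simp]: "sorted_part X V vs (tick c) = sorted_part X V vs c"
  by (simp add: sorted_part_def ok_def)

text \<open>The ghost value is the list of incoming edges of \<open>p\<close> not yet treated. Each
  of them holds a potential of 202 + 2 * \<tau>, which pays for one \<open>sort_step\<close> and the
  two jumps of a round.\<close>

lemma wp_sort_inner:
  assumes c: "sorted_part ({j. j < m \<and> dst j \<in> V} - set js) V vs c" "reg c 6 = fld p 0"
      "in_list (mem c) (reg c 8) js"
    and js: "distinct js" "set js \<subseteq> {j. j < m \<and> dst j = p}" and p: "p \<in> V"
  shows "wp M (While 8 sort_step) (\<lambda>c'. (\<exists>vs. sorted_part {j. j < m \<and> dst j \<in> V} V vs c') \<and>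
     clock c' \<le> clock c + (202 + 2 * \<tau>) * length js + 1) c"
proof -
  define T where "T = clock c + (202 + 2 * \<tau>) * length js"
  let ?I = "\<lambda>js c'. (\<exists>vs. sorted_part ({j. j < m \<and> dst j \<in> V} - set js) V vs c') \<and> reg c' 6 = fld p 0 \<and>
    in_list (mem c') (reg c' 8) js \<and> distinct js \<and> set js \<subseteq> {j. j < m \<and> dst j = p} \<and>
    clock c' + (202 + 2 * \<tau>) * length js \<le> T"
  show ?thesis
    unfolding T_def[symmetric]
  proof (rule wp_While_ghost[where f = length and x = js and I = ?I])
    show "?I js c" using assms by (auto simp: T_def)
  next
    fix ks c' assume I: "?I ks c'" and nz: "reg c' 8 \<noteq> 0"
    then obtain e ks' where ks: "ks = e # ks'" by (cases ks) auto
    obtain vs' where vs': "sorted_part ({j. j < m \<and> dst j \<in> V} - set ks) V vs' (tick c')"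
      using I by auto
    have X: "insert e ({j. j < m \<and> dst j \<in> V} - set ks) = {j. j < m \<and> dst j \<in> V} - set ks'"
      using I ks p by auto
    have "wp M sort_step (\<lambda>c''. (\<exists>vs. sorted_part ({j. j < m \<and> dst j \<in> V} - set ks') V vs c'') \<and>
        reg c'' 6 = fld p 0 \<and> in_list (mem c'') (reg c'' 8) ks' \<and>
        clock c'' \<le> clock (tick c') + 200 + 2 * \<tau>) (tick c')"
      unfolding X[symmetric] by (rule wp_sort_step[OF vs']) (use I ks p in auto)
    then show "wp M sort_step (\<lambda>c''. \<exists>ks'. ?I ks' (tick c'') \<and> length ks' < length ks) (tick c')"
      by (rule wp_mono) (use I ks in \<open>intro exI[of _ ks'], auto\<close>)
  next
    fix ks c' assume "?I ks c'" "reg c' 8 = 0"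
    then show "(\<exists>vs. sorted_part {j. j < m \<and> dst j \<in> V} V vs (tick c')) \<and> clock (tick c') \<le> T + 1"
      by (cases ks) auto
  qed
qed

text \<open>Between rounds the processed edges are exactly \<open>E V\<close>, the edges into
  vertices taken from the worklist. Charging time to \<open>card (E V)\<close> and
  \<open>card V\<close> makes the total linear, although a single round may handle many
  edges.\<close>

lemma wp_sort_loop:
  assumes c: "sorted_part {} {} vs c"
  shows "wp M sort_loop (\<lambda>c'. static (mem c') \<and> ok c' \<and> (\<exists>N G. indexed (mem c') {..<m} N G) \<and>
     clock c' \<le> clock c + (202 + 2 * \<tau>) * m + 20 * n + 1) c"
  unfolding sort_loop_def
proof -
  define E where "E V = {j. j < m \<and> dst j \<in> V}" for V
  let ?K = "202 + 2 * \<tau>"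
  let ?I = "\<lambda>V c'. (\<exists>vs. sorted_part (E V) V vs c') \<and> clock c' \<le> clock c + ?K * card (E V) + 20 * card V"
  have fin_E [simp]: "finite (E V)" for V by (simp add: E_def)
  show "wp M (While 15 (Prim (Move 6 15) ;; get 15 6 9 ;; get 8 6 1 ;; While 8 sort_step))
    (\<lambda>c'. static (mem c') \<and> ok c' \<and> (\<exists>N G. indexed (mem c') {..<m} N G) \<and>
     clock c' \<le> clock c + ?K * m + 20 * n + 1) c"
  proof (rule wp_While_ghost[where f = "\<lambda>V. n - card V" and x = "{}" and I = ?I])
    show "?I {} c" using c by (auto simp: E_def)
  next
    fix V c' assume I: "?I V c'" and nz: "reg c' 15 \<noteq> 0"
    obtain vs where vs: "sorted_part (E V) V vs c'" using I by blast
    then obtain p vs' where p: "vs = p # vs'"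
      using nz unfolding sorted_part_def by (cases vs) auto
    have *: "ok c'" "static (mem c')" "\<exists>N G. indexed (mem c') (E V) N G"
      "\<forall>u<n. mem c' (fld u 0) = card {j. j < m \<and> src j = u \<and> j \<notin> E V}"
      "worklist (mem c') (reg c' 15) vs" "distinct vs"
      "set vs = {u. u < n \<and> u \<notin> V \<and> (\<forall>j<m. src j = u \<longrightarrow> j \<in> E V)}"
      "V \<subseteq> {..<n}" "E V \<subseteq> {..<m}" "\<forall>j<m. src j \<in> V \<longrightarrow> j \<in> E V"
      using vs unfolding sorted_part_def by blast+
    have pn: "p < n" "p \<notin> V" "\<forall>j<m. src j = p \<longrightarrow> j \<in> E V" using *(7) p by auto
    have finV: "finite V" using *(8) finite_subset by blast
    define js where "js = rev (filter (\<lambda>k. dst k = p) [0..<m])"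
    have js: "in_list (mem c') (mem c' (fld p 1)) js" "distinct js" "set js = {j. j < m \<and> dst j = p}"
      using *(2) pn(1) by (auto simp: static_def js_def)
    have EV: "E V = E (insert p V) - set js"
      using pn(2) js(3) by (auto simp: E_def)
    have "E (insert p V) = E V \<union> set js" "E V \<inter> set js = {}"
      using js(3) pn(2) by (auto simp: E_def)
    then have card_E: "card (E (insert p V)) = card (E V) + length js"
      using distinct_card[OF js(2)] by (simp add: card_Un_disjoint)
    have card_V: "card (insert p V) = Suc (card V)" "card (insert p V) \<le> n"
      using finV pn card_mono[of "{..<n}" "insert p V"] *(8) by auto
    have set_vs': "set vs' = {u. u < n \<and> u \<notin> insert p V \<and> (\<forall>j<m. src j = u \<longrightarrow> j \<in> E V)}"
      using *(6,7) p by auto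
    have step: "sorted_part (E (insert p V) - set js) (insert p V) vs' c''"
      if "ok c''" "mem c'' = mem c'" "reg c'' 15 = mem c' (fld p 9)" for c''
      using that * set_vs' pn p unfolding EV[symmetric] sorted_part_def by auto
    have 15: "reg c' 15 = fld p 0" using *(5) p by simp
    have "wp M (While 8 sort_step) (\<lambda>c''. \<exists>V'. ?I V' (tick c'') \<and> n - card V' < n - card V) c''"
      if c'': "ok c''" "mem c'' = mem c'" "reg c'' 15 = mem c' (fld p 9)" "reg c'' 6 = fld p 0"
        "reg c'' 8 = mem c' (fld p 1)" "clock c'' \<le> clock c' + 10" for c''
    proof (rule wp_mono)
      show "wp M (While 8 sort_step) (\<lambda>c'. (\<exists>vs. sorted_part (E (insert p V)) (insert p V) vs c') \<and>
          clock c' \<le> clock c'' + ?K * length js + 1) c''"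
        unfolding E_def by (rule wp_sort_inner) (use step[OF c''(1-3)] js c'' in \<open>auto simp: E_def\<close>)
      show "\<exists>V'. ?I V' (tick d) \<and> n - card V' < n - card V"
        if "(\<exists>vs. sorted_part (E (insert p V)) (insert p V) vs d) \<and>
          clock d \<le> clock c'' + ?K * length js + 1" for d
        using I card_E card_V that c''(6) by (intro exI[of _ "insert p V"]) (auto simp: algebra_simps)
    qed
    then show "wp M (Prim (Move 6 15) ;; get 15 6 9 ;; get 8 6 1 ;; While 8 sort_step)
       (\<lambda>c''. \<exists>V'. ?I V' (tick c'') \<and> n - card V' < n - card V) (tick c')"
      using *(1)[unfolded ok_def] 15 pn(1)
      by (simp add: wp_simps ok_def)
  next
    fix V c' assume I: "?I V c'" and z: "reg c' 15 = 0"
    obtain vs where vs: "sorted_part (E V) V vs c'" using I by blast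
    then have "vs = []"
      using z unfolding sorted_part_def by (cases vs) auto
    then have "{u. u < n \<and> u \<notin> V \<and> (\<forall>j<m. src j = u \<longrightarrow> j \<in> E V)} = {}"
      using vs unfolding sorted_part_def by simp
    then have none: "\<exists>j<m. src j = u \<and> j \<notin> E V" if "u < n" "u \<notin> V" for u
      using that by blast
    \<comment> \<open>Acyclicity enters here. With the worklist empty, a vertex outside
      \<open>V\<close> has an unprocessed outgoing edge, whose end point is again outside
      \<open>V\<close>; induction along reversed edges excludes this.\<close>
    let ?R = "{(src j, dst j) | j. j < m}"
    have "finite ?R" by simp
    then have "wf (?R\<inverse>)"
      using acyclic_edges by (rule finite_acyclic_wf_converse)
    then have "u < n \<Longrightarrow> u \<in> V" for u
    proof (induction u rule: wf_induct_rule)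
      case (less u)
      show ?case
      proof (rule ccontr)
        assume "u \<notin> V"
        then obtain j where j: "j < m" "src j = u" "j \<notin> E V" using none less.prems by blast
        then have "dst j \<in> V" using less.IH[of "dst j"] dst_less by blast
        then show False using j by (simp add: E_def)
      qed
    qed
    then have V: "V = {..<n}" using vs by (auto simp: sorted_part_def)
    then have E: "E V = {..<m}" using dst_less by (auto simp: E_def)
    show "static (mem (tick c')) \<and> ok (tick c') \<and> (\<exists>N G. indexed (mem (tick c')) {..<m} N G) \<and>
        clock (tick c') \<le> clock c + ?K * m + 20 * n + 1"
      using vs I unfolding sorted_part_def E by (auto simp: V ok_def)
  qed
qed

lemma worklist_less_W: "worklist \<mu> a vs \<Longrightarrow> \<forall>v\<in>set vs. v < n \<Longrightarrow> a < W"
  by (cases vs) auto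

lemma edges_done_link:
  assumes "edges_done m c" "mem c' = (mem c)(fld v 9 := x)" "v < n"
  shows "edges_done m c'"
proof -
  have in_list: "in_list (mem c') a js = in_list (mem c) a js" for a js
    using assms(2) by (intro in_list_cong) simp
  show ?thesis
    using assms unfolding edges_done_def in_list by simp
qed

lemma edges_done_tick [simp]: "edges_done j (tick c) = edges_done j c"
  by (simp add: edges_done_def)

lemma edges_done_imp_sorted_part:
  assumes "ok c" "edges_done m c" "worklist (mem c) (reg c 15) vs" "distinct vs"
    "set vs = {v. v < n \<and> mem c (fld v 0) = 0}"
  shows "sorted_part {} {} vs c"
proof -
  have deg: "mem c (fld v 0) = card {j. j < m \<and> src j = v}" if "v < n" for v
  proof -
    have "mem c (fld v 0) = length (filter (\<lambda>k. src k = v) [0..<m])"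
      using assms(2) that by (simp add: edges_done_def)
    also have "\<dots> = card (set (filter (\<lambda>k. src k = v) [0..<m]))"
      by (rule distinct_card[symmetric]) simp
    also have "set (filter (\<lambda>k. src k = v) [0..<m]) = {j. j < m \<and> src j = v}" by auto
    finally show ?thesis .
  qed
  have "card {j. j < m \<and> src j = v} = 0 \<longleftrightarrow> (\<forall>j<m. src j \<noteq> v)" for v
    by (subst card_0_eq) auto
  then have vs: "set vs = {v. v < n \<and> (\<forall>j<m. src j \<noteq> v)}"
    using assms(5) deg by auto
  have "static (mem c)"
    using assms(2) input_n input_m by (simp add: edges_done_def static_def)
  moreover have "vert (mem c) {} (\<lambda>_. []) u (if target u then [[]] else [])" if "u < n" for u
    using assms(2) that by (auto simp: edges_done_def vert_def entry_def cont_def)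
  moreover have "found {} u = (if target u then {[]} else {})" for u
    by (auto simp: found_def)
  ultimately have "\<exists>ps. vert (mem c) {} (\<lambda>_. []) u ps \<and> distinct ps \<and> set ps = found {} u" if "u < n" for u
    using that by (intro exI[of _ "if target u then [[]] else []"]) auto
  then have "indexed (mem c) {} {} (\<lambda>_. [])"
    unfolding indexed_def by simp
  then show ?thesis
    using assms \<open>static (mem c)\<close> deg vs unfolding sorted_part_def by auto
qed

lemma wp_init_worklist:
  assumes "ok c" "edges_done m c"
    and Q: "\<And>c' vs. ok c' \<Longrightarrow> sorted_part {} {} vs c' \<Longrightarrow> clock c' \<le> clock c + 40 * n + 10 \<Longrightarrow> Q c'"
  shows "wp M init_worklist Q c"
proof -
  note okc = assms(1)[unfolded ok_def]
  define \<mu> where "\<mu> = mem c"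
  let ?vs = "\<lambda>i. rev (filter (\<lambda>v. \<mu> (fld v 0) = 0) [0..<i])"
  let ?I = "\<lambda>c'. ok c' \<and> edges_done m c' \<and> (\<exists>i\<le>n. worklist (mem c') (reg c' 15) (?vs i) \<and>
    (\<forall>v. mem c' (fld v 0) = \<mu> (fld v 0)) \<and>
    reg c' 7 = fld i 0 \<and> reg c' 9 = n - i \<and> clock c' \<le> clock c + 40 * i + 6)"
  show ?thesis
    unfolding init_worklist_def using okc
    apply (simp add: wp_simps)
    apply (rule wp_While[where I = ?I and f = "\<lambda>c. reg c 9"])
    subgoal
      using assms(2) by (intro conjI exI[of _ 0]) (simp_all add: ok_def edges_done_def \<mu>_def flip: fld_0_0)
    subgoal premises prems for c'
      using prems
    proof (elim conjE exE)
      fix i assume *: "reg c' 9 \<noteq> 0" "ok c'" "edges_done m c'" "i \<le> n"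
        "worklist (mem c') (reg c' 15) (?vs i)" "\<forall>v. mem c' (fld v 0) = \<mu> (fld v 0)"
        "reg c' 7 = fld i 0" "reg c' 9 = n - i" "clock c' \<le> clock c + 40 * i + 6"
      then have i: "i < n" by simp
      note ok' = \<open>ok c'\<close>[unfolded ok_def]
      have "reg c' 15 < W"
        by (rule worklist_less_W[OF *(5)]) (use i in auto)
      have wl: "worklist ((mem c')(fld i 9 := x)) a (?vs i) = worklist (mem c') a (?vs i)" for x a
        by (rule worklist_cong) auto
      have ed: "edges_done m c''" if "mem c'' = (mem c')(fld i 9 := x)" for c'' x
        using edges_done_link[OF *(3) that i] .
      have ed': "edges_done m c''" if "mem c'' = mem c'" for c''
        using *(3) that by (simp add: edges_done_def)
      show ?thesis
      proof (cases "\<mu> (fld i 0) = 0")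
        case True
        show ?thesis
          using * i ok' \<open>reg c' 15 < W\<close> ed[of _ "reg c' 15"]
          apply (simp add: wp_simps cell_Suc True wl)
          apply (auto simp: ok_def)
          done
      next
        case False
        show ?thesis
          using * i ok' ed'
          apply (simp add: wp_simps cell_Suc False)
          apply (auto simp: ok_def)
          done
      qed
    qed
    subgoal premises prems for c'
      using prems(2,3)
    proof (elim conjE exE)
      fix i assume *: "reg c' 9 = 0" "ok c'" "edges_done m c'" "i \<le> n"
        "worklist (mem c') (reg c' 15) (?vs i)" "\<forall>v. mem c' (fld v 0) = \<mu> (fld v 0)"
        "reg c' 9 = n - i" "clock c' \<le> clock c + 40 * i + 6"
      then have i: "i = n" by simp
      show "Q (tick c')"
      proof (rule Q)
        show ok: "ok (tick c')" using *(2) by (simp add: ok_def)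
        show "sorted_part {} {} (?vs n) (tick c')"
          by (rule edges_done_imp_sorted_part[OF ok]) (use * i in auto)
        show "clock (tick c') \<le> clock c + 40 * n + 10" using *(8) i by simp
      qed
    qed
    done
qed

lemma wp_prep:
  assumes "\<forall>a. \<mu>0 a < W"
  shows "wp M prep_cmd (\<lambda>c. static (mem c) \<and> ok c \<and> (\<exists>N G. indexed (mem c) {..<m} N G) \<and>
    clock c \<le> (400 + 2 * \<tau>) * (n + m + 1)) (start 0 \<mu>0)"
  unfolding prep_cmd_def wp_Seq
  apply (rule wp_preamble)
  apply (simp_all add: start_def assms input_n input_m input_m[simplified])
  apply (rule wp_init_verts, assumption, assumption)
  apply (rule wp_init_edges, assumption+)
  apply (rule wp_init_worklist, assumption+)
  apply (rule wp_mono, rule wp_sort_loop, assumption)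
  apply (auto simp: algebra_simps)
  done

end

section \<open>Decorated DAGs as networks\<close>

lemma terminal_Cons: "terminal (v, (i, u) # p) = terminal (u, p)"
  by (simp add: terminal_def)

lemma terminal_in_verts:
  "is_dag D \<Longrightarrow> v \<in> verts D \<Longrightarrow> steps_ok (edges D) v p \<Longrightarrow> terminal (v, p) \<in> verts D"
proof (induction p arbitrary: v)
  case Nil
  then show ?case by (simp add: terminal_def)
next
  case (Cons x p)
  then show ?case by (cases x) (auto simp: terminal_Cons is_dag_def)
qed

lemma Comp_in_Hom:
  "is_category C \<Longrightarrow> a \<in> Obj C \<Longrightarrow> b \<in> Obj C \<Longrightarrow> c \<in> Obj C \<Longrightarrow>
    f \<in> Hom C a b \<Longrightarrow> g \<in> Hom C b c \<Longrightarrow> Comp C f g \<in> Hom C a c"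
  unfolding is_category_def by blast

lemma Comp_assoc:
  "is_category C \<Longrightarrow> a \<in> Obj C \<Longrightarrow> b \<in> Obj C \<Longrightarrow> c \<in> Obj C \<Longrightarrow> d \<in> Obj C \<Longrightarrow>
    f \<in> Hom C a b \<Longrightarrow> g \<in> Hom C b c \<Longrightarrow> h \<in> Hom C c d \<Longrightarrow>
    Comp C (Comp C f g) h = Comp C f (Comp C g h)"
  unfolding is_category_def by blast

text \<open>\<open>steps_mor\<close> stops at the last edge without appending an identity; the right
  unit law restores a uniform recursion.\<close>

lemma steps_mor_Cons:
  assumes "is_category C" "is_dag D" "is_decoration C D" "(v, i, u) \<in> edges D"
  shows "steps_mor C D v ((i, u) # p) = Comp C (edec D (v, i, u)) (steps_mor C D u p)"
proof (cases p)
  case Nil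
  have "v \<in> verts D" "u \<in> verts D" using assms(2,4) by (auto simp: is_dag_def)
  then have "vdec D v \<in> Obj C" "vdec D u \<in> Obj C" "edec D (v, i, u) \<in> Hom C (vdec D v) (vdec D u)"
    using assms(3,4) by (auto simp: is_decoration_def)
  then show ?thesis using assms(1) Nil by (simp add: is_category_def)
qed simp

lemma steps_mor_in_Hom:
  assumes "is_category C" "is_dag D" "is_decoration C D" "v \<in> verts D" "steps_ok (edges D) v p"
  shows "steps_mor C D v p \<in> Hom C (vdec D v) (vdec D (terminal (v, p)))"
  using assms(4,5)
proof (induction p arbitrary: v)
  case Nil
  then show ?case using assms(1,3) by (simp add: is_category_def is_decoration_def terminal_def)
next
  case (Cons x p)
  obtain i u where x: "x = (i, u)" by (cases x)
  then have e: "(v, i, u) \<in> edges D" "steps_ok (edges D) u p" using Cons.prems by auto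
  then have u: "u \<in> verts D" using assms(2) by (auto simp: is_dag_def)
  have "vdec D v \<in> Obj C" "vdec D u \<in> Obj C" "vdec D (terminal (u, p)) \<in> Obj C"
    "edec D (v, i, u) \<in> Hom C (vdec D v) (vdec D u)"
    using assms(3) Cons.prems u e terminal_in_verts[OF assms(2) u e(2)] by (auto simp: is_decoration_def)
  then show ?case
    using Cons.IH[OF u e(2)] assms(1) unfolding x steps_mor_Cons[OF assms(1-3) e(1)] terminal_Cons
    by (blast intro: Comp_in_Hom)
qed

lemma steps_mor_append:
  assumes "is_category C" "is_dag D" "is_decoration C D" "v \<in> verts D"
    "steps_ok (edges D) v p" "steps_ok (edges D) (terminal (v, p)) q"
  shows "steps_mor C D v (p @ q) = Comp C (steps_mor C D v p) (steps_mor C D (terminal (v, p)) q)"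
  using assms(4-6)
proof (induction p arbitrary: v)
  case Nil
  have "vdec D v \<in> Obj C" "vdec D (terminal (v, q)) \<in> Obj C"
    using assms(3) Nil terminal_in_verts[OF assms(2) Nil(1), of q]
    by (auto simp: is_decoration_def terminal_def)
  then show ?case
    using assms(1) steps_mor_in_Hom[OF assms(1-3) Nil(1), of q] Nil
    by (simp add: is_category_def terminal_def)
next
  case (Cons x p)
  obtain i u where x: "x = (i, u)" by (cases x)
  then have e: "(v, i, u) \<in> edges D" "steps_ok (edges D) u p" using Cons.prems by auto
  then have u: "u \<in> verts D" using assms(2) by (auto simp: is_dag_def)
  have q: "steps_ok (edges D) (terminal (u, p)) q" using Cons.prems x by (simp add: terminal_Cons)
  let ?t = "terminal (u, p)"
  have t: "?t \<in> verts D" using terminal_in_verts[OF assms(2) u e(2)] .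
  have "vdec D v \<in> Obj C" "vdec D u \<in> Obj C" "vdec D ?t \<in> Obj C" "vdec D (terminal (?t, q)) \<in> Obj C"
    "edec D (v, i, u) \<in> Hom C (vdec D v) (vdec D u)"
    "steps_mor C D u p \<in> Hom C (vdec D u) (vdec D ?t)"
    "steps_mor C D ?t q \<in> Hom C (vdec D ?t) (vdec D (terminal (?t, q)))"
    using assms(3) Cons.prems u e t q terminal_in_verts[OF assms(2) t q]
      steps_mor_in_Hom[OF assms(1-3)] by (auto simp: is_decoration_def)
  then show ?case
    unfolding x append_Cons steps_mor_Cons[OF assms(1-3) e(1)] terminal_Cons Cons.IH[OF u e(2) q]
    by (rule Comp_assoc[OF assms(1), symmetric])
qed

section \<open>Vertex numbers and the layout of the input\<close>

lemma vertex_no_less: "v \<in> set vs \<Longrightarrow> vertex_no vs v < length vs"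
  unfolding vertex_no_def by (induction vs) auto

lemma nth_vertex_no: "v \<in> set vs \<Longrightarrow> vs ! vertex_no vs v = v"
  unfolding vertex_no_def by (induction vs) auto

lemma vertex_no_nth: "distinct vs \<Longrightarrow> i < length vs \<Longrightarrow> vertex_no vs (vs ! i) = i"
  by (metis nth_eq_iff_index_eq nth_mem nth_vertex_no vertex_no_less)

lemma acyclic_inv_image:
  assumes "acyclic r"
  shows "acyclic (inv_image r f)"
proof -
  have "(x, y) \<in> (inv_image r f)\<^sup>+ \<Longrightarrow> (f x, f y) \<in> r\<^sup>+" for x y
    by (induction rule: trancl_induct) (auto intro: trancl_into_trancl simp: inv_image_def)
  then show ?thesis using assms unfolding acyclic_def by blast
qed

lemma concat_triples_nth:
  assumes "j < length xs" "k < 3" "\<And>x. length (f x) = 3"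
  shows "concat (map f xs) ! (3 * j + k) = f (xs ! j) ! k"
  using assms(1)
proof (induction xs arbitrary: j)
  case (Cons x xs)
  then show ?case
    using assms(2,3) by (cases j) (simp_all add: nth_append)
qed simp

lemma length_concat_triples: "(\<And>x. length (f x) = 3) \<Longrightarrow> length (concat (map f xs)) = 3 * length xs"
  by (induction xs) auto

section \<open>Paths as lists of edge numbers, and transfer to the decorated DAG\<close>

locale listed_dag =
  fixes C :: "('o, 'm) category" and D :: "('v, 'i, 'o, 'm) decorated_graph" and V0 :: "'v set"
    and vs :: "'v list" and es :: "('v \<times> 'i \<times> 'v) list" and enc :: "'m \<Rightarrow> nat" and M :: ram
  assumes category: "is_category C" and dag: "is_dag D" and decoration: "is_decoration C D"
    and vs: "distinct vs" "set vs = verts D" and es: "distinct es" "set es = edges D"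
    and room: "64 * (dag_size D + 1) \<le> 2 ^ width M"
    and enc_less: "\<pi> \<in> paths D \<Longrightarrow> enc (path_mor C D \<pi>) < 2 ^ width M"
    and enc_comp: "\<pi>\<^sub>1 \<in> paths D \<Longrightarrow> \<pi>\<^sub>2 \<in> paths D \<Longrightarrow> terminal \<pi>\<^sub>1 = fst \<pi>\<^sub>2 \<Longrightarrow>
      comp_op M (enc (path_mor C D \<pi>\<^sub>1)) (enc (path_mor C D \<pi>\<^sub>2)) =
      enc (Comp C (path_mor C D \<pi>\<^sub>1) (path_mor C D \<pi>\<^sub>2))"
begin

abbreviation "n \<equiv> length vs"
abbreviation "m \<equiv> length es"
abbreviation "src j \<equiv> vertex_no vs (fst (es ! j))"
abbreviation "dst j \<equiv> vertex_no vs (snd (snd (es ! j)))"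
abbreviation "steps p \<equiv> map (\<lambda>j. snd (es ! j)) p"
abbreviation "code u p \<equiv> enc (path_mor C D (vs ! u, steps p))"
abbreviation "input \<equiv> memory_of (input_words C D V0 enc vs es)"

lemma edge_verts: "j < m \<Longrightarrow> fst (es ! j) \<in> set vs" "j < m \<Longrightarrow> snd (snd (es ! j)) \<in> set vs"
  using dag vs es nth_mem[of j es] unfolding is_dag_def by auto

lemma src_less: "j < m \<Longrightarrow> src j < n" and dst_less: "j < m \<Longrightarrow> dst j < n"
  using edge_verts vertex_no_less by metis+

lemma nth_src: "j < m \<Longrightarrow> vs ! src j = fst (es ! j)" and nth_dst: "j < m \<Longrightarrow> vs ! dst j = snd (snd (es ! j))"
  using edge_verts nth_vertex_no by metis+

lemma chain_terminal:
  "u < n \<Longrightarrow> chain m src dst u p \<Longrightarrow> chain_end dst u p < n \<and>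
     terminal (vs ! u, steps p) = vs ! chain_end dst u p"
proof (induction p arbitrary: u)
  case Nil
  then show ?case by (simp add: terminal_def)
next
  case (Cons j p)
  then have "terminal (vs ! dst j, steps p) = vs ! chain_end dst (dst j) p" "chain_end dst (dst j) p < n"
    by (simp_all add: dst_less)
  then show ?case
    using Cons.prems terminal_Cons[of "vs ! u" "fst (snd (es ! j))" "snd (snd (es ! j))" "steps p"]
    by (simp add: nth_dst)
qed

lemma chain_paths:
  "u < n \<Longrightarrow> chain m src dst u p \<Longrightarrow> (vs ! u, steps p) \<in> paths D"
proof (induction p arbitrary: u)
  case Nil
  then show ?case using vs(2) nth_mem[of u vs] by (simp add: paths_def)
next
  case (Cons j p)
  then have j: "j < m" "vs ! u = fst (es ! j)" using nth_src[of j] by auto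
  have "(fst (es ! j), fst (snd (es ! j)), snd (snd (es ! j))) \<in> edges D"
    using es(2) nth_mem[OF j(1)] by simp
  moreover have "(vs ! dst j, steps p) \<in> paths D"
    using Cons dst_less[OF j(1)] by auto
  ultimately show ?case
    using j nth_dst[OF j(1)] dag unfolding paths_def is_dag_def
    by (cases "es ! j") auto
qed

lemma paths_chain:
  "u < n \<Longrightarrow> steps_ok (edges D) (vs ! u) q \<Longrightarrow> \<exists>p. chain m src dst u p \<and> q = steps p"
proof (induction q arbitrary: u)
  case Nil
  then show ?case by (intro exI[of _ "[]"]) simp
next
  case (Cons x q)
  obtain i v where x: "x = (i, v)" by (cases x)
  then have "(vs ! u, i, v) \<in> set es" using Cons.prems es by simp
  then obtain j where j: "j < m" "es ! j = (vs ! u, i, v)" by (meson in_set_conv_nth)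
  have "vs ! dst j = v" using nth_dst[OF j(1)] j(2) by simp
  then obtain p where p: "chain m src dst (dst j) p" "q = steps p"
    using Cons x dst_less[OF j(1)] by auto
  have "src j = u" using j Cons.prems(1) vertex_no_nth[OF vs(1)] by simp
  then show ?case using j p x by (intro exI[of _ "j # p"]) simp
qed

text \<open>\<open>steps\<close> keeps only the index and the end of each edge. The start is known
  along a chain, so the whole edge is determined, and its number as well since \<open>es\<close> is
  distinct; parallel edges stay apart by their indices.\<close>

lemma steps_inj:
  "chain m src dst u p \<Longrightarrow> chain m src dst u q \<Longrightarrow> steps p = steps q \<Longrightarrow> p = q"
proof (induction p arbitrary: u q)
  case (Cons j p)
  obtain k q' where q: "q = k # q'" using Cons.prems by (cases q) auto
  have "j < m" "k < m" "src j = src k" "snd (es ! j) = snd (es ! k)" using Cons.prems q by auto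
  moreover have "fst (es ! j) = fst (es ! k)" using calculation nth_src by metis
  ultimately have "j = k" using es(1) by (metis nth_eq_iff_index_eq prod.expand)
  then show ?case using Cons q by auto
qed simp

lemma size_D: "dag_size D = n + m"
  unfolding dag_size_def using distinct_card[OF vs(1)] distinct_card[OF es(1)] vs es by simp

lemma code_append:
  assumes "u < n" "chain m src dst u p" "chain m src dst (chain_end dst u p) q"
  shows "comp_op M (code u p) (code (chain_end dst u p) q) = code u (p @ q)"
proof -
  have e: "chain_end dst u p < n" "terminal (vs ! u, steps p) = vs ! chain_end dst u p"
    using chain_terminal[OF assms(1,2)] by auto
  have p: "(vs ! u, steps p) \<in> paths D" and q: "(vs ! chain_end dst u p, steps q) \<in> paths D"
    using chain_paths assms e(1) by auto
  then have "path_mor C D (vs ! u, steps (p @ q)) =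
      Comp C (path_mor C D (vs ! u, steps p)) (path_mor C D (vs ! chain_end dst u p, steps q))"
    using steps_mor_append[OF category dag decoration, of "vs ! u" "steps p" "steps q"] e(2)
    by (simp add: path_mor_def paths_def)
  then show ?thesis
    using enc_comp[OF p q] e(2) by simp
qed

lemma length_input_words: "length (input_words C D V0 enc vs es) = 2 + 2 * n + 3 * m"
  unfolding input_words_def by (simp add: length_concat_triples split: prod.split)

lemma network: "network n m src dst (\<lambda>i. vs ! i \<in> V0) code M input"
proof
  fix j assume j: "j < m"
  let ?f = "\<lambda>(u, i, v). [vertex_no vs u, vertex_no vs v, enc (edec D (u, i, v))]"
  have f: "length (?f x) = 3" for x by (auto split: prod.split)
  have w: "input (2 + 2 * n + 3 * j + k) = ?f (es ! j) ! k" if "k < 3" for k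
  proof -
    have "input (2 + 2 * n + 3 * j + k) = concat (map ?f es) ! (3 * j + k)"
      using j that unfolding memory_of_def length_input_words
      by (simp add: input_words_def nth_append)
    then show ?thesis using concat_triples_nth[of j es k ?f, OF j that f] by simp
  qed
  show "src j < n" "dst j < n" using j src_less dst_less by auto
  show "input (2 + 2 * n + 3 * j) = src j"
    using w[of 0] by (simp add: case_prod_beta)
  show "input (2 + 2 * n + 3 * j + 1) = dst j"
    using w[of 1] by (simp add: case_prod_beta)
  show "input (2 + 2 * n + 3 * j + 2) = code (src j) [j]"
    using w[of 2] nth_src[OF j] by (cases "es ! j") (simp add: path_mor_def)
next
  have "{(src j, dst j) |j. j < m} \<subseteq> inv_image {(u, v). \<exists>i. (u, i, v) \<in> edges D} (\<lambda>i. vs ! i)"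
  proof
    fix x assume "x \<in> {(src j, dst j) |j. j < m}"
    then obtain j where j: "j < m" "x = (src j, dst j)" by blast
    then have "(fst (es ! j), fst (snd (es ! j)), snd (snd (es ! j))) \<in> edges D"
      using es(2) nth_mem[of j es] by simp
    then show "x \<in> inv_image {(u, v). \<exists>i. (u, i, v) \<in> edges D} (\<lambda>i. vs ! i)"
      using j nth_src[OF j(1)] nth_dst[OF j(1)] by (cases "es ! j") (auto simp: inv_image_def)
  qed
  then show "acyclic {(src j, dst j) |j. j < m}"
    using dag acyclic_inv_image acyclic_subset unfolding is_dag_def by blast
next
  show "64 * (n + m + 1) \<le> 2 ^ width M" using room size_D by simp
next
  fix u p assume "u < n" "chain m src dst u p"
  then show "code u p < 2 ^ width M" using enc_less chain_paths by blast
next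
  show "input 0 = n" "input 1 = m"
    unfolding memory_of_def length_input_words by (simp_all add: input_words_def)
next
  fix i assume i: "i < n"
  show "input (2 + i) = code i []"
    using i unfolding memory_of_def length_input_words
    by (simp add: input_words_def nth_append)
  show "input (2 + n + i) = (if vs ! i \<in> V0 then 1 else 0)"
    using i unfolding memory_of_def length_input_words
    by (simp add: input_words_def nth_append)
next
  fix a assume "2 + 2 * n + 3 * m \<le> a"
  then show "input a = 0" by (simp add: memory_of_def length_input_words)
qed (fact code_append)

lemma input_less_width: "input a < 2 ^ width M"
proof -
  interpret network n m src dst "\<lambda>i. vs ! i \<in> V0" code M input by (rule network)
  have "x < W" if "x \<in> set (input_words C D V0 enc vs es)" for x
  proof -
    have "x = n \<or> x = m \<or> (\<exists>v\<in>set vs. x = enc (path_mor C D (v, []))) \<or> x = 0 \<or> x = 1 \<or>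
      (\<exists>(u, i, v)\<in>set es. x = vertex_no vs u \<or> x = vertex_no vs v \<or> x = enc (edec D (u, i, v)))"
      using that unfolding input_words_def by (auto split: if_splits)
    moreover have "enc (path_mor C D (v, [])) < W" if "v \<in> set vs" for v
      using that vs by (intro enc_less) (simp add: paths_def)
    moreover have "vertex_no vs u < W" "vertex_no vs v < W" "enc (edec D (u, i, v)) < W"
      if "(u, i, v) \<in> set es" for u i v
    proof -
      have uv: "u \<in> set vs" "v \<in> set vs" using that dag vs es by (auto simp: is_dag_def)
      then show "vertex_no vs u < W" "vertex_no vs v < W"
        using vertex_no_less[of u vs] vertex_no_less[of v vs] less_W(1) by (simp_all add: less_imp_le)
      have "(u, [(i, v)]) \<in> paths D" using that uv vs es by (simp add: paths_def)
      then show "enc (edec D (u, i, v)) < W" using enc_less[of "(u, [(i, v)])"] by (simp add: path_mor_def)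
    qed
    moreover have "n < W" "m < W" "0 < W" "1 < W" using room' by linarith+
    ultimately show ?thesis by fast
  qed
  then show ?thesis by (simp add: memory_of_def)
qed

lemma correct:
  "\<exists>\<mu>. computes_within M (compile 0 prep_cmd) input \<mu> ((400 + 2 * comp_time M) * (dag_size D + 1)) \<and>
     (\<forall>s\<in>verts D. \<exists>xs. enumerates M (compile 0 query_cmd) \<mu> (vertex_no vs s) xs (200 + 5 * comp_time M) \<and>
        mset xs = image_mset (\<lambda>\<pi>. (vertex_no vs (terminal \<pi>), enc (path_mor C D \<pi>)))
          (mset_set (paths_from_to D s V0)))"
proof -
  interpret network n m src dst "\<lambda>i. vs ! i \<in> V0" code M input by (rule network)
  have "wp M prep_cmd (\<lambda>c. static (mem c) \<and> ok c \<and> (\<exists>N G. indexed (mem c) {..<m} N G) \<and>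
    clock c \<le> (400 + 2 * \<tau>) * (n + m + 1)) (start 0 input)"
    by (rule wp_prep) (simp add: input_less_width)
  from wp_compile[OF this] obtain k where
    k: "let c = (step M (compile 0 prep_cmd) ^^ k) (start 0 input) in
      static (mem c) \<and> ok c \<and> (\<exists>N G. indexed (mem c) {..<m} N G) \<and>
      clock c \<le> (400 + 2 * \<tau>) * (n + m + 1) \<and> halted (compile 0 prep_cmd) c"
    by (auto simp: ok_def Let_def)
  define \<mu> where "\<mu> = mem ((step M (compile 0 prep_cmd) ^^ k) (start 0 input))"
  have \<mu>: "\<forall>a. \<mu> a < W" "\<mu> 0 = n" "\<mu> 1 = m"
    using k by (auto simp: \<mu>_def Let_def static_def ok_def)
  obtain N G where ix: "indexed \<mu> {..<m} N G" using k by (auto simp: \<mu>_def Let_def)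
  have "\<exists>xs. enumerates M (compile 0 query_cmd) \<mu> (vertex_no vs s) xs (200 + 5 * \<tau>) \<and>
      mset xs = image_mset (\<lambda>\<pi>. (vertex_no vs (terminal \<pi>), enc (path_mor C D \<pi>)))
        (mset_set (paths_from_to D s V0))" if s: "s \<in> verts D" for s
  proof -
    let ?s = "vertex_no vs s"
    have sn: "?s < n" "vs ! ?s = s" using s vs(2) by (simp_all add: vertex_no_less nth_vertex_no)
    obtain ps where ps: "vert \<mu> N G ?s ps" "distinct ps" "set ps = found {..<m} ?s"
      using ix sn unfolding indexed_def by blast
    have "wp M query_cmd (\<lambda>c. map snd (trace c) = map (out ?s) ps @ [End] \<and>
        successively (\<lambda>t t'. t' \<le> t + (200 + 5 * \<tau>)) (0 # map fst (trace c))) (start ?s \<mu>)"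
      using ix sn(1) ps(1) \<mu> unfolding indexed_def by (intro wp_query) auto
    from wp_compile[OF this] obtain k where
      "let c = (step M (compile 0 query_cmd) ^^ k) (start ?s \<mu>) in
        halted (compile 0 query_cmd) c \<and> map snd (trace c) = map (out ?s) ps @ [End] \<and>
        successively (\<lambda>t t'. t' \<le> t + (200 + 5 * \<tau>)) (0 # map fst (trace c))"
      by (auto simp: Let_def)
    then have "enumerates M (compile 0 query_cmd) \<mu> ?s
        (map (\<lambda>p. (fin ?s p, code ?s p)) ps) (200 + 5 * \<tau>)"
      unfolding enumerates_def out_def[abs_def] by (auto simp: o_def)
    moreover have "mset (map (\<lambda>p. (fin ?s p, code ?s p)) ps) =
        image_mset (\<lambda>\<pi>. (vertex_no vs (terminal \<pi>), enc (path_mor C D \<pi>)))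
          (mset_set (paths_from_to D s V0))"
    proof -
      \<comment> \<open>This is a bijection from the distinct list \<open>ps\<close> onto the paths
        from \<open>s\<close> to targets. End points and codes are taken only afterwards, so equal
        pairs from different paths keep their multiplicity.\<close>
      let ?h = "\<lambda>p. (s, steps p)"
      have chains: "path ?s p" if "p \<in> set ps" for p using that ps(3) by (simp add: found_def)
      have "paths_from_to D s V0 = ?h ` set ps"
      proof (intro equalityI subsetI)
        fix \<pi> assume "\<pi> \<in> paths_from_to D s V0"
        then obtain q where q: "\<pi> = (s, q)" "steps_ok (edges D) s q" "terminal (s, q) \<in> V0"
          by (cases \<pi>) (auto simp: paths_from_to_def paths_def)
        then obtain p where p: "path ?s p" "q = steps p" using paths_chain[OF sn(1)] sn(2) by auto
        then have "vs ! fin ?s p \<in> V0" using chain_terminal[OF sn(1) p(1)] sn(2) q(3) by simp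
        then have "p \<in> set ps" using p(1) ps(3) by (cases p) (auto simp: found_def)
        then show "\<pi> \<in> ?h ` set ps" using q(1) p(2) by blast
      next
        fix \<pi> assume "\<pi> \<in> ?h ` set ps"
        then obtain p where p: "p \<in> set ps" "\<pi> = (s, steps p)" by blast
        then show "\<pi> \<in> paths_from_to D s V0"
          using chain_paths[OF sn(1) chains] chain_terminal[OF sn(1) chains] sn(2) ps(3)
          by (simp add: paths_from_to_def found_def)
      qed
      moreover have "inj_on ?h (set ps)"
        using steps_inj chains by (intro inj_onI) blast
      ultimately have "mset_set (paths_from_to D s V0) = image_mset ?h (mset_set (set ps))"
        by (simp add: image_mset_mset_set)
      moreover have "(fin ?s p, code ?s p) = (vertex_no vs (terminal (?h p)), enc (path_mor C D (?h p)))"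
        if "p \<in> set ps" for p
        using chain_terminal[OF sn(1) chains[OF that]] sn(2) vertex_no_nth[OF vs(1)] by simp
      then have "image_mset (\<lambda>p. (fin ?s p, code ?s p)) (mset ps) =
          image_mset (\<lambda>p. (vertex_no vs (terminal (?h p)), enc (path_mor C D (?h p)))) (mset ps)"
        by (intro image_mset_cong) simp
      ultimately show ?thesis
        using ps(2) by (simp only: mset_set_set image_mset.compositionality o_def mset_map)
    qed
    ultimately show ?thesis by blast
  qed
  moreover have "computes_within M (compile 0 prep_cmd) input \<mu> ((400 + 2 * \<tau>) * (dag_size D + 1))"
    using k unfolding computes_within_def \<mu>_def size_D by (auto simp: Let_def)
  ultimately show ?thesis by blast
qed

end

theorem theorem3p1:
  fixes C :: "('o, 'm) category" and \<tau> :: nat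
  assumes "is_category C"
  shows "\<exists>prep query c\<^sub>w c\<^sub>p c\<^sub>d.
    \<forall>(D :: ('v, 'i, 'o, 'm) decorated_graph) V0 vs es w enc op.
      is_dag D \<longrightarrow> is_decoration C D \<longrightarrow> V0 \<subseteq> verts D \<longrightarrow>
      distinct vs \<longrightarrow> set vs = verts D \<longrightarrow>
      distinct es \<longrightarrow> set es = edges D \<longrightarrow>
      c\<^sub>w * (dag_size D + 1) \<le> 2 ^ w \<longrightarrow>
      (\<forall>v\<in>verts D. fits_register w (vertex_no vs v)) \<longrightarrow>
      (\<forall>\<pi>\<in>paths D. fits_register w (enc (path_mor C D \<pi>))) \<longrightarrow>
      inj_on enc (path_mor C D ` paths D) \<longrightarrow>
      (\<forall>\<pi>\<^sub>1\<in>paths D. \<forall>\<pi>\<^sub>2\<in>paths D. terminal \<pi>\<^sub>1 = fst \<pi>\<^sub>2 \<longrightarrow>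
         op (enc (path_mor C D \<pi>\<^sub>1)) (enc (path_mor C D \<pi>\<^sub>2)) =
         enc (Comp C (path_mor C D \<pi>\<^sub>1) (path_mor C D \<pi>\<^sub>2))) \<longrightarrow>
      (let M = \<lparr>width = w, comp_op = op, comp_time = \<tau>\<rparr> in
       \<exists>\<mu>. computes_within M prep (memory_of (input_words C D V0 enc vs es)) \<mu>
             (c\<^sub>p * (dag_size D + 1)) \<and>
           (\<forall>s\<in>verts D. \<exists>xs. enumerates M query \<mu> (vertex_no vs s) xs c\<^sub>d \<and>
              mset xs = image_mset (\<lambda>\<pi>. (vertex_no vs (terminal \<pi>), enc (path_mor C D \<pi>)))
                          (mset_set (paths_from_to D s V0))))"
\<comment> \<open>The witnesses are chosen before the DAG and depend on nothing but \<tau>; 64 is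
  the factor in the assumption \<open>room\<close>.\<close>
proof (rule exI[of _ "compile 0 prep_cmd"], rule exI[of _ "compile 0 query_cmd"], rule exI[of _ 64],
    rule exI[of _ "400 + 2 * \<tau>"], rule exI[of _ "200 + 5 * \<tau>"], intro allI impI)
  fix D :: "('v, 'i, 'o, 'm) decorated_graph" and V0 vs es w enc op
  assume a: "is_dag D" "is_decoration C D" "distinct vs" "set vs = verts D"
    "distinct es" "set es = edges D" "64 * (dag_size D + 1) \<le> 2 ^ w"
    "\<forall>\<pi>\<in>paths D. fits_register w (enc (path_mor C D \<pi>))"
    "\<forall>\<pi>\<^sub>1\<in>paths D. \<forall>\<pi>\<^sub>2\<in>paths D. terminal \<pi>\<^sub>1 = fst \<pi>\<^sub>2 \<longrightarrow>
         op (enc (path_mor C D \<pi>\<^sub>1)) (enc (path_mor C D \<pi>\<^sub>2)) =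
         enc (Comp C (path_mor C D \<pi>\<^sub>1) (path_mor C D \<pi>\<^sub>2))"
  define M where "M = \<lparr>width = w, comp_op = op, comp_time = \<tau>\<rparr>"
  interpret listed_dag C D V0 vs es enc M
  proof
    show "enc (path_mor C D \<pi>) < 2 ^ width M" if "\<pi> \<in> paths D" for \<pi>
      using a(8) that by (simp add: fits_register_def M_def)
    show "comp_op M (enc (path_mor C D \<pi>\<^sub>1)) (enc (path_mor C D \<pi>\<^sub>2)) =
        enc (Comp C (path_mor C D \<pi>\<^sub>1) (path_mor C D \<pi>\<^sub>2))"
      if "\<pi>\<^sub>1 \<in> paths D" "\<pi>\<^sub>2 \<in> paths D" "terminal \<pi>\<^sub>1 = fst \<pi>\<^sub>2" for \<pi>\<^sub>1 \<pi>\<^sub>2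
      using a(9) that by (simp add: M_def)
  qed (use assms a in \<open>simp_all add: M_def\<close>)
  have "comp_time M = \<tau>" by (simp add: M_def)
  show "let M = \<lparr>width = w, comp_op = op, comp_time = \<tau>\<rparr> in
       \<exists>\<mu>. computes_within M (compile 0 prep_cmd) (memory_of (input_words C D V0 enc vs es)) \<mu>
             ((400 + 2 * \<tau>) * (dag_size D + 1)) \<and>
           (\<forall>s\<in>verts D. \<exists>xs. enumerates M (compile 0 query_cmd) \<mu> (vertex_no vs s) xs (200 + 5 * \<tau>) \<and>
              mset xs = image_mset (\<lambda>\<pi>. (vertex_no vs (terminal \<pi>), enc (path_mor C D \<pi>)))
                          (mset_set (paths_from_to D s V0)))"
    using correct unfolding Let_def M_def[symmetric] \<open>comp_time M = \<tau>\<close> .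
qed

end
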